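(* Let $J_0\equiv 0$ on $\mathcal I$ and let $(J_k)_{k=0}^\infty$ be generated by $J_{k+1}(I)=(TJ_k)(I)$, $I\in\mathcal I$. Then $(J_k)_{k=0}^\infty$ converges uniformly to the optimal cost $J^*$ with respect to the metric $d$, i.e. $\lim_{k\to\infty}\sup_{I\in\mathcal I}|J_k(I)-J^*(I)|=0$.
   Context: Process. $X\subset\mathbb R^n$ is a compact continuous state space, $S$ a finite discrete state space, $U$ a (continuous or discrete) action space, $\gamma\in[0,1)$ a discount factor. The system is $\mathbf x(k+1)\sim p_{\mathbf x}(\cdot|\mathbf x(k),\mathbf s(k),\mathbf u(k))$ (a probability density, which may put mass outside $X$) and $\mathbf s(k+1)\sim p_{\mathbf s}(\cdot|\mathbf s(k),\mathbf x(k))$ (a probability mass function on $S$). The reward $\mathbf r(x,u)$ is a random variable whose law depends only on $(x,u)\in X\times U$, with mean $R(x,u)=\mathbb E[\mathbf r(x,u)]\in[0,M]$ for all $(x,u)\in X\times U$, where $M>0$. Information state. Only $\mathbf x(k)$ is observed. For a fixed $L\in\mathbb N$, $\mathbf I(k)=(\mathbf x(k),\mathbf x(k-1),\ldots,\mathbf x(k-L))\in\mathcal I:=X^{L+1}$. A generic value of $\mathbf I(0)$ is written $I=(x(0),x(-1),\ldots,x(-L))$, and then $\mathbf I(1)=(\mathbf x(1),x(0),\ldots,x(-L+1))$. Markov assumption. The process $(\mathbf I(k),\mathbf u(k))_{k=0}^{\tau}$ satisfies the Markov property: the conditional law of $\mathbf I(k+1)$ given $\mathbf I(0),\ldots,\mathbf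 I(k)$ and $\mathbf u(k)=u$ depends only on $\mathbf I(k)$ and $u$ (with a time-invariant transition density). The conditional density of $\mathbf x(1)$ given $\mathbf I(0)=I,\mathbf u(0)=u$ is written $p_{\mathbf x}(x(1)|I,u)$. Policies and values. $\Pi$ is the set of admissible deterministic policies $\pi:\mathcal I\to U$. Under the stationary policy $\pi$, $\mathbf u(k)=\pi(\mathbf I(k))$. The stopping time $\tau=\tau(\mathbf I(0);\pi)$ (possibly infinite) is the first time step such that $\mathbf x(\tau+1)\notin X$; $\tau=-1$ if $\mathbf x(0)\notin X$. The value function is $J^\pi(I)=\mathbb E[\sum_{i=0}^{\tau(\mathbf I(0);\pi)}\gamma^i\,\mathbf r(\mathbf x(i),\pi(\mathbf I(i)))\,|\,\mathbf I(0)=I]$. The optimal cost is $J^*:=J^{\pi^*}$, where $\pi^*\in\Pi$ is an optimal policy, i.e. $J^{\pi^*}(I)=\inf_{\pi\in\Pi}J^\pi(I)$ for all $I\in\mathcal I$ (existence of $\pi^*$ is presupposed in the definition of $J^*$). Operator and metric. $\mathbb I_X$ is the indicator function of $X$. For bounded $J_0:\mathcal I\to\mathbb R_+$, $$(TJ_0)(I)=\inf_{u\in U}\{R(x(0),u)+\gamma\,\mathbb E[\mathbb I_X(\mathbf x(1))J_0(\mathbf I(1))|\mathbf I(0)=I,\mathbf u(0)=u]\}=\inf_{u\in U}\Big\{R(x(0),u)+\gamma\int_{x(1)\in X}J_0(x(1),x(0),\ldots,x(-L+1))\,p_{\mathbf x}(x(1)|I,u)\,dx(1)\Big\}.$$ The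 metric is $d(J,J')=\sup_{I\in\mathcal I}|J(I)-J'(I)|$ on the space of bounded functions $\mathcal I\to\mathbb R_+$. All functions whose expectation is taken are tacitly assumed measurable.
   Formalization: The formal theorem also assumes that the discounted sum of absolute rewards up to τ has finite expectation for every policy and initial I; bounding only the mean R leaves J^π possibly undefined. This is automatic for nonnegative rewards or bounded E|r(x,u)|. *)

theory Defs
  imports "HOL-Probability.Probability"
begin

text \<open>
  An information state \<open>(x(0), x(-1), \<dots>, x(-L))\<close> is an extensional function \<open>I\<close> on \<open>{..L}\<close>
  with \<open>I j = x(-j)\<close>. The action space is an arbitrary measurable space \<open>U\<close>, so that continuous and
  discrete actions are covered alike.
\<close>

definition info_states :: "(real ^ 'n) set \<Rightarrow> nat \<Rightarrow> (nat \<Rightarrow> real ^ 'n) set" where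
  "info_states X L = {..L} \<rightarrow>\<^sub>E X"

definition info_space :: "(real ^ 'n) set \<Rightarrow> nat \<Rightarrow> (nat \<Rightarrow> real ^ 'n) measure" where
  "info_space X L = (\<Pi>\<^sub>M j\<in>{..L}. restrict_space borel X)"

lemma space_info_space: "space (info_space X L) = info_states X L"
  by (simp add: info_space_def info_states_def space_PiM space_restrict_space)

definition next_info :: "nat \<Rightarrow> (nat \<Rightarrow> real ^ 'n) \<Rightarrow> real ^ 'n \<Rightarrow> (nat \<Rightarrow> real ^ 'n)" where
  "next_info L I y = (\<lambda>j\<in>{..L}. if j = 0 then y else I (j - 1))"

text \<open>Admissible means measurable; the values of a policy off \<^term>\<open>info_states X L\<close> are never used.\<close>

definition policies ::
  "(real ^ 'n) set \<Rightarrow> nat \<Rightarrow> 'u measure \<Rightarrow> ((nat \<Rightarrow> real ^ 'n) \<Rightarrow> 'u) set" where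
  "policies X L U = info_space X L \<rightarrow>\<^sub>M U"


subsection \<open>Model data\<close>

text \<open>Densities are on all of \<open>\<real>\<^sup>n\<close> and may put mass outside \<open>X\<close>.\<close>

definition prob_density :: "('a::euclidean_space \<Rightarrow> real) \<Rightarrow> bool" where
  "prob_density f \<longleftrightarrow>
     f \<in> borel_measurable borel \<and> (\<forall>y. 0 \<le> f y) \<and> (\<integral>\<^sup>+ y. ennreal (f y) \<partial>lborel) = 1"

definition state_density ::
  "(real ^ 'n) set \<Rightarrow> 's set \<Rightarrow> 'u measure \<Rightarrow> (real ^ 'n \<Rightarrow> 's \<Rightarrow> 'u \<Rightarrow> real ^ 'n \<Rightarrow> real) \<Rightarrow> bool" where
  "state_density X S U px \<longleftrightarrow>
     (\<forall>a\<in>X. \<forall>\<sigma>\<in>S. \<forall>u\<in>space U. prob_density (px a \<sigma> u)) \<and>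
     (\<forall>\<sigma>\<in>S. (\<lambda>((a, u), y). px a \<sigma> u y)
        \<in> borel_measurable ((restrict_space borel X \<Otimes>\<^sub>M U) \<Otimes>\<^sub>M borel))"

definition discrete_kernel ::
  "(real ^ 'n) set \<Rightarrow> 's set \<Rightarrow> ('s \<Rightarrow> real ^ 'n \<Rightarrow> 's pmf) \<Rightarrow> bool" where
  "discrete_kernel X S ps \<longleftrightarrow>
     (\<forall>a\<in>X. \<forall>\<sigma>\<in>S. set_pmf (ps \<sigma> a) \<subseteq> S) \<and>
     (\<forall>\<sigma>\<in>S. \<forall>\<sigma>'\<in>S. (\<lambda>a. pmf (ps \<sigma> a) \<sigma>') \<in> borel_measurable (restrict_space borel X))"

definition reward_kernel ::
  "(real ^ 'n) set \<Rightarrow> 'u measure \<Rightarrow> (real ^ 'n \<Rightarrow> 'u \<Rightarrow> real measure) \<Rightarrow> bool" where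
  "reward_kernel X U \<rho> \<longleftrightarrow>
     (\<lambda>(a, u). \<rho> a u) \<in> restrict_space borel X \<Otimes>\<^sub>M U \<rightarrow>\<^sub>M prob_algebra borel \<and>
     (\<forall>a\<in>X. \<forall>u\<in>space U. integrable (\<rho> a u) (\<lambda>z. z))"

definition mean_reward :: "(real ^ 'n \<Rightarrow> 'u \<Rightarrow> real measure) \<Rightarrow> real ^ 'n \<Rightarrow> 'u \<Rightarrow> real" where
  "mean_reward \<rho> a u = (\<integral>z. z \<partial>\<rho> a u)"

definition info_density ::
  "(real ^ 'n) set \<Rightarrow> nat \<Rightarrow> 'u measure \<Rightarrow> ((nat \<Rightarrow> real ^ 'n) \<Rightarrow> 'u \<Rightarrow> real ^ 'n \<Rightarrow> real) \<Rightarrow> bool" where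
  "info_density X L U p \<longleftrightarrow>
     (\<forall>I\<in>info_states X L. \<forall>u\<in>space U. prob_density (p I u)) \<and>
     (\<lambda>((I, u), y). p I u y) \<in> borel_measurable ((info_space X L \<Otimes>\<^sub>M U) \<Otimes>\<^sub>M borel)"


subsection \<open>Trajectories\<close>

text \<open>The continuous state \<open>x\<close> is indexed by the times \<open>-L, -L + 1, \<dots>\<close>.\<close>

definition info_at :: "nat \<Rightarrow> (int \<Rightarrow> 'w \<Rightarrow> real ^ 'n) \<Rightarrow> nat \<Rightarrow> 'w \<Rightarrow> (nat \<Rightarrow> real ^ 'n)" where
  "info_at L x k \<omega> = (\<lambda>j\<in>{..L}. x (int k - int j) \<omega>)"

text \<open>One less than the first exit time from \<open>X\<close>: \<open>-1\<close> if \<open>x(0) \<notin> X\<close>, and \<open>\<infinity>\<close> if \<open>X\<close> is never left.\<close>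

definition stop_time :: "(real ^ 'n) set \<Rightarrow> (int \<Rightarrow> 'w \<Rightarrow> real ^ 'n) \<Rightarrow> 'w \<Rightarrow> ereal" where
  "stop_time X x \<omega> = (INF k\<in>{k::nat. x (int k) \<omega> \<notin> X}. ereal (real k)) - 1"

definition alive ::
  "'w measure \<Rightarrow> (real ^ 'n) set \<Rightarrow> (int \<Rightarrow> 'w \<Rightarrow> real ^ 'n) \<Rightarrow> nat \<Rightarrow> 'w set" where
  "alive P X x k = {\<omega> \<in> space P. ereal (real k) \<le> stop_time X x \<omega>}"

text \<open>The \<open>\<sigma>\<close>-algebra of \<open>x(-L), \<dots>, x(k), s(0), \<dots>, s(k)\<close>, and that of \<open>I(0), \<dots>, I(k)\<close>.\<close>

definition state_history ::
  "'w measure \<Rightarrow> 's set \<Rightarrow> nat \<Rightarrow> (int \<Rightarrow> 'w \<Rightarrow> real ^ 'n) \<Rightarrow> (nat \<Rightarrow> 'w \<Rightarrow> 's) \<Rightarrow> nat \<Rightarrow> 'w measure" where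
  "state_history P S L x s k =
     vimage_algebra (space P)
       (\<lambda>\<omega>. (\<lambda>i\<in>{- int L..int k}. x i \<omega>, \<lambda>i\<in>{..k}. s i \<omega>))
       ((\<Pi>\<^sub>M i\<in>{- int L..int k}. borel) \<Otimes>\<^sub>M (\<Pi>\<^sub>M i\<in>{..k}. count_space S))"

definition info_history ::
  "'w measure \<Rightarrow> nat \<Rightarrow> (int \<Rightarrow> 'w \<Rightarrow> real ^ 'n) \<Rightarrow> nat \<Rightarrow> 'w measure" where
  "info_history P L x k =
     vimage_algebra (space P) (\<lambda>\<omega>. \<lambda>i\<in>{..k}. info_at L x i \<omega>)
       (\<Pi>\<^sub>M i\<in>{..k}. \<Pi>\<^sub>M j\<in>{..L}. borel)"

text \<open>On the event \<open>E\<close>, the conditional law under \<open>P\<close> of the \<open>N\<close>-valued variable \<open>Y\<close> given \<open>F\<close> is \<open>\<kappa>\<close>.\<close>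

definition cond_law_on ::
  "'w measure \<Rightarrow> 'w measure \<Rightarrow> 'w set \<Rightarrow> 'b measure \<Rightarrow> ('w \<Rightarrow> 'b) \<Rightarrow> ('w \<Rightarrow> 'b measure) \<Rightarrow> bool" where
  "cond_law_on P F E N Y \<kappa> \<longleftrightarrow>
     (\<forall>B\<in>sets N. AE \<omega> in P. \<omega> \<in> E \<longrightarrow>
        real_cond_exp P F (\<lambda>\<omega>. indicator B (Y \<omega>)) \<omega> = measure (\<kappa> \<omega>) B)"

text \<open>
  \<open>P\<close> is the law of the system under the stationary policy \<open>\<pi>\<close>, conditional on \<open>I(0) = I\<close>; the action
  at time \<open>k\<close> is \<open>\<pi> (I(k))\<close>, and \<open>r k\<close> is the realised reward at time \<open>k\<close>. The dynamics are
  prescribed only up to the stopping time, since \<open>\<pi>\<close> and all kernels are given only on \<open>X\<close>.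
\<close>

definition controlled_process ::
  "(real ^ 'n) set \<Rightarrow> 's set \<Rightarrow> nat
    \<Rightarrow> (real ^ 'n \<Rightarrow> 's \<Rightarrow> 'u \<Rightarrow> real ^ 'n \<Rightarrow> real) \<Rightarrow> ('s \<Rightarrow> real ^ 'n \<Rightarrow> 's pmf)
    \<Rightarrow> (real ^ 'n \<Rightarrow> 'u \<Rightarrow> real measure)
    \<Rightarrow> (int \<Rightarrow> 'w \<Rightarrow> real ^ 'n) \<Rightarrow> (nat \<Rightarrow> 'w \<Rightarrow> 's) \<Rightarrow> (nat \<Rightarrow> 'w \<Rightarrow> real)
    \<Rightarrow> ((nat \<Rightarrow> real ^ 'n) \<Rightarrow> 'u) \<Rightarrow> (nat \<Rightarrow> real ^ 'n) \<Rightarrow> 'w measure \<Rightarrow> bool" where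
  "controlled_process X S L px ps \<rho> x s r \<pi> I P \<longleftrightarrow>
     prob_space P \<and>
     (\<forall>i \<ge> - int L. x i \<in> borel_measurable P) \<and>
     (\<forall>k. s k \<in> P \<rightarrow>\<^sub>M count_space S) \<and>
     (\<forall>k. r k \<in> borel_measurable P) \<and>
     (AE \<omega> in P. info_at L x 0 \<omega> = I) \<and>
     (\<forall>k. cond_law_on P (state_history P S L x s k) (alive P X x k) borel (x (int k + 1))
        (\<lambda>\<omega>. density lborel
           (\<lambda>y. ennreal (px (x (int k) \<omega>) (s k \<omega>) (\<pi> (info_at L x k \<omega>)) y)))) \<and>
     (\<forall>k. cond_law_on P (state_history P S L x s k) (alive P X x k) (count_space S) (s (Suc k))
        (\<lambda>\<omega>. measure_pmf (ps (s k \<omega>) (x (int k) \<omega>)))) \<and>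
     (\<forall>k. cond_law_on P (state_history P S L x s k) (alive P X x k) borel (r k)
        (\<lambda>\<omega>. \<rho> (x (int k) \<omega>) (\<pi> (info_at L x k \<omega>))))"

text \<open>
  Markov assumption: given \<open>I(0), \<dots>, I(k)\<close> and \<open>u(k) = u\<close>, the conditional law of \<open>I(k+1)\<close> is that of
  \<^term>\<open>next_info L (I(k)) y\<close> with \<open>y\<close> drawn from the density \<^term>\<open>p (I(k)) u\<close>.
\<close>

definition markov_info ::
  "(real ^ 'n) set \<Rightarrow> nat \<Rightarrow> ((nat \<Rightarrow> real ^ 'n) \<Rightarrow> 'u \<Rightarrow> real ^ 'n \<Rightarrow> real)
    \<Rightarrow> (int \<Rightarrow> 'w \<Rightarrow> real ^ 'n) \<Rightarrow> ((nat \<Rightarrow> real ^ 'n) \<Rightarrow> 'u) \<Rightarrow> 'w measure \<Rightarrow> bool" where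
  "markov_info X L p x \<pi> P \<longleftrightarrow>
     (\<forall>k. cond_law_on P (info_history P L x k) (alive P X x k)
        (\<Pi>\<^sub>M j\<in>{..L}. borel) (info_at L x (Suc k))
        (\<lambda>\<omega>. distr
           (density lborel (\<lambda>y. ennreal (p (info_at L x k \<omega>) (\<pi> (info_at L x k \<omega>)) y)))
           (\<Pi>\<^sub>M j\<in>{..L}. borel) (next_info L (info_at L x k \<omega>))))"


subsection \<open>Values and the Bellman operator\<close>

definition value_fun ::
  "(real ^ 'n) set \<Rightarrow> real \<Rightarrow> (int \<Rightarrow> 'w \<Rightarrow> real ^ 'n) \<Rightarrow> (nat \<Rightarrow> 'w \<Rightarrow> real)
    \<Rightarrow> (((nat \<Rightarrow> real ^ 'n) \<Rightarrow> 'u) \<Rightarrow> (nat \<Rightarrow> real ^ 'n) \<Rightarrow> 'w measure)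
    \<Rightarrow> ((nat \<Rightarrow> real ^ 'n) \<Rightarrow> 'u) \<Rightarrow> (nat \<Rightarrow> real ^ 'n) \<Rightarrow> real" where
  "value_fun X \<gamma> x r P \<pi> I =
     (\<integral>\<omega>. (\<Sum>i. if ereal (real i) \<le> stop_time X x \<omega> then \<gamma> ^ i * r i \<omega> else 0) \<partial>P \<pi> I)"

text \<open>
  Existence of the expectation in \<^const>\<open>value_fun\<close>. A bound on the mean rewards alone does not give
  this; it is automatic if the rewards are nonnegative or have bounded absolute means.
\<close>

definition reward_sum_integrable ::
  "(real ^ 'n) set \<Rightarrow> real \<Rightarrow> (int \<Rightarrow> 'w \<Rightarrow> real ^ 'n) \<Rightarrow> (nat \<Rightarrow> 'w \<Rightarrow> real) \<Rightarrow> 'w measure \<Rightarrow> bool" where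
  "reward_sum_integrable X \<gamma> x r P \<longleftrightarrow>
     (\<integral>\<^sup>+ \<omega>. (\<Sum>i. if ereal (real i) \<le> stop_time X x \<omega> then ennreal (\<gamma> ^ i * \<bar>r i \<omega>\<bar>) else 0) \<partial>P) < \<infinity>"

definition optimal_policy ::
  "(real ^ 'n) set \<Rightarrow> nat \<Rightarrow> 'u measure
    \<Rightarrow> (((nat \<Rightarrow> real ^ 'n) \<Rightarrow> 'u) \<Rightarrow> (nat \<Rightarrow> real ^ 'n) \<Rightarrow> real)
    \<Rightarrow> ((nat \<Rightarrow> real ^ 'n) \<Rightarrow> 'u) \<Rightarrow> bool" where
  "optimal_policy X L U V \<pi>' \<longleftrightarrow>
     \<pi>' \<in> policies X L U \<and>
     (\<forall>I\<in>info_states X L. V \<pi>' I = (INF \<pi>\<in>policies X L U. V \<pi> I))"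

definition bellman ::
  "(real ^ 'n) set \<Rightarrow> nat \<Rightarrow> 'u measure \<Rightarrow> real \<Rightarrow> (real ^ 'n \<Rightarrow> 'u \<Rightarrow> real)
    \<Rightarrow> ((nat \<Rightarrow> real ^ 'n) \<Rightarrow> 'u \<Rightarrow> real ^ 'n \<Rightarrow> real)
    \<Rightarrow> ((nat \<Rightarrow> real ^ 'n) \<Rightarrow> real) \<Rightarrow> (nat \<Rightarrow> real ^ 'n) \<Rightarrow> real" where
  "bellman X L U \<gamma> R p J I =
     (INF u\<in>space U. R (I 0) u + \<gamma> * (LINT y:X|lborel. J (next_info L I y) * p I u y))"

definition sup_dist ::
  "(real ^ 'n) set \<Rightarrow> nat \<Rightarrow> ((nat \<Rightarrow> real ^ 'n) \<Rightarrow> real) \<Rightarrow> ((nat \<Rightarrow> real ^ 'n) \<Rightarrow> real) \<Rightarrow> real" where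
  "sup_dist X L J J' = (SUP I\<in>info_states X L. \<bar>J I - J' I\<bar>)"

end

theory Submission
  imports Defs
begin

text \<open>
  Value iteration converges because \<open>J\<^sup>*\<close> is a fixed point of the Bellman operator \<open>T\<close>
  and \<open>T\<close> contracts the supremum norm by \<open>\<gamma>\<close>
  (\<open>bellman_contraction\<close>): \<open>J\<^sup>*\<close> lies between \<open>0\<close> and \<open>M / (1 - \<gamma>)\<close>, so \<open>T\<^sup>k 0\<close> is
  within \<open>\<gamma>\<^sup>k M / (1 - \<gamma>)\<close> of it (\<open>value_iteration_error\<close>). The work lies in the
  fixed-point equation.

  First, the value of a policy, which is an expectation over trajectories, has to be expressed through the
  transition density \<open>p\<close> of the information state. The event of having stayed in \<open>X\<close> up to time \<open>k\<close> and
  all information states up to time \<open>k\<close> belong to the history at time \<open>k\<close>, so one application of the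
  Markov property trades a function of \<open>I(k+1)\<close> on the survival event at \<open>k+1\<close> for its one-step
  conditional expectation on the survival event at \<open>k\<close> (\<open>surviving_mean_Suc\<close>). Iterating back to
  time \<open>0\<close> shows that the expected \<open>k\<close>-th reward is obtained from the mean reward by \<open>k\<close> applications of
  the one-step operator, and \<open>J\<^sup>\<pi>\<close> is the discounted sum of these numbers
  (\<open>expected_discounted_reward\<close>). Hence \<open>J\<^sup>\<pi>\<close> depends measurably on the
  initial information state and is bounded by \<open>M / (1 - \<gamma>)\<close>.

  Secondly, \<open>J\<^sup>* \<le> T J\<^sup>*\<close> usually calls for a non-stationary policy or a measurable choice of
  nearly optimal actions. Densities offer a shorter way: given an information state \<open>H\<close> and an action \<open>u\<close>,
  the optimal policy is changed to \<open>u\<close> at the single point \<open>H\<close>. Since the next observation has a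
  Lebesgue density, \<open>H\<close> is revisited with probability zero, so the changed policy plays \<open>u\<close> once and
  behaves optimally from then on (\<open>policy_value_update\<close>). Optimality at \<open>H\<close> then says
  exactly that \<open>J\<^sup>*(H)\<close> is at most the Bellman expression for \<open>u\<close>, with equality when \<open>u\<close> is the optimal
  action itself (\<open>optimal_value_fixed_point\<close>).
\<close>

section \<open>Integrating against a conditional law\<close>

text \<open>
  Both sides are integrals of \<open>g\<close>: on the left against the law of \<open>Y\<close> under \<open>P\<close> restricted to \<open>E\<close>, on
  the right against the mixture of the kernel \<open>K\<close> over \<open>P\<close> restricted to \<open>E\<close>. The two measures agree on
  every set because \<open>E\<close> belongs to the conditioning \<open>\<sigma>\<close>-algebra. The kernel \<open>K\<close> is a version of \<open>\<kappa>\<close>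
  that is measurable on the whole space; in the applications \<open>\<kappa>\<close> is meaningful on \<open>E\<close> only.
\<close>

lemma cond_law_on_nn_integral:
  assumes "prob_space P" and "subalgebra P F" and "E \<in> sets F" and "E \<subseteq> E'"
    and Y [measurable]: "Y \<in> P \<rightarrow>\<^sub>M N" and K [measurable]: "K \<in> P \<rightarrow>\<^sub>M subprob_algebra N"
    and "\<And>\<omega>. \<omega> \<in> E \<Longrightarrow> \<kappa> \<omega> = K \<omega>"
    and law: "cond_law_on P F E' N Y \<kappa>"
    and g [measurable]: "g \<in> borel_measurable N"
  shows "(\<integral>\<^sup>+\<omega>. indicator E \<omega> * g (Y \<omega>) \<partial>P) = (\<integral>\<^sup>+\<omega>. indicator E \<omega> * (\<integral>\<^sup>+z. g z \<partial>K \<omega>) \<partial>P)"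
proof -
  interpret prob_space P by fact
  interpret finite_measure_subalgebra P F by standard fact
  have E [measurable]: "E \<in> sets P"
    using assms(2,3) by (auto simp: subalgebra_def)
  define D where "D = density P (indicator E)"
  have D [measurable_cong]: "sets D = sets P"
    by (simp add: D_def)
  have [measurable]: "K \<in> D \<rightarrow>\<^sub>M subprob_algebra N" "Y \<in> D \<rightarrow>\<^sub>M N"
    by measurable
  have "space D \<noteq> {}"
    using not_empty by (simp add: D_def)
  have "distr D N Y = D \<bind> K"
  proof (rule measure_eqI)
    show "sets (distr D N Y) = sets (D \<bind> K)"
      using \<open>space D \<noteq> {}\<close> by (simp add: sets_bind_measurable[where B = N])
  next
    fix B assume "B \<in> sets (distr D N Y)"
    then have B [measurable]: "B \<in> sets N" by simp
    let ?f = "\<lambda>\<omega>. indicator B (Y \<omega>) :: real"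
    have int: "integrable P (\<lambda>\<omega>. indicator E \<omega> * ?f \<omega>)"
      by (rule integrable_const_bound[of _ 1]) (auto simp: indicator_def)
    have ae: "AE \<omega> in P. indicator E \<omega> * real_cond_exp P F ?f \<omega> = indicator E \<omega> * measure (K \<omega>) B"
      using law[unfolded cond_law_on_def, rule_format, OF B] assms(4,7)
      by (auto simp: indicator_def split: if_splits)
    have "emeasure (distr D N Y) B = (\<integral>\<^sup>+z. indicator B z \<partial>distr D N Y)"
      by simp
    also have "\<dots> = (\<integral>\<^sup>+\<omega>. indicator B (Y \<omega>) \<partial>D)"
      by (rule nn_integral_distr) measurable
    also have "\<dots> = (\<integral>\<^sup>+\<omega>. ennreal (indicator E \<omega> * ?f \<omega>) \<partial>P)"
      unfolding D_def
      by (subst nn_integral_density) (auto intro!: nn_integral_cong simp: indicator_def)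
    also have "\<dots> = ennreal (\<integral>\<omega>. indicator E \<omega> * ?f \<omega> \<partial>P)"
      by (rule nn_integral_eq_integral[OF int]) simp
    also have "(\<integral>\<omega>. indicator E \<omega> * ?f \<omega> \<partial>P) = (\<integral>\<omega>. indicator E \<omega> * real_cond_exp P F ?f \<omega> \<partial>P)"
      using int assms(3) by (intro real_cond_exp_intg(2)[symmetric]) auto
    also have "\<dots> = (\<integral>\<omega>. indicator E \<omega> * measure (K \<omega>) B \<partial>P)"
      using ae assms(3) by (intro integral_cong_AE) (auto intro!: borel_measurable_times borel_measurable_indicator borel_measurable_cond_exp2)
    also have "ennreal \<dots> = (\<integral>\<^sup>+\<omega>. ennreal (indicator E \<omega> * measure (K \<omega>) B) \<partial>P)"
    proof (rule nn_integral_eq_integral[symmetric])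
      have "measure (K \<omega>) B \<le> 1" if "\<omega> \<in> space P" for \<omega>
        using measurable_space[OF K that] subprob_space.subprob_measure_le_1
        by (auto simp: space_subprob_algebra)
      then show "integrable P (\<lambda>\<omega>. indicator E \<omega> * measure (K \<omega>) B)"
        by (intro integrable_const_bound[of _ 1]) (auto simp: indicator_def)
    qed simp
    also have "\<dots> = (\<integral>\<^sup>+\<omega>. indicator E \<omega> * emeasure (K \<omega>) B \<partial>P)"
    proof (rule nn_integral_cong)
      fix \<omega> assume "\<omega> \<in> space P"
      then interpret subprob_space "K \<omega>"
        using measurable_space[OF K] by (auto simp: space_subprob_algebra)
      show "ennreal (indicator E \<omega> * measure (K \<omega>) B) = indicator E \<omega> * emeasure (K \<omega>) B"
        by (auto simp: indicator_def emeasure_eq_measure)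
    qed
    also have "\<dots> = (\<integral>\<^sup>+\<omega>. emeasure (K \<omega>) B \<partial>D)"
      unfolding D_def by (subst nn_integral_density) auto
    also have "\<dots> = emeasure (D \<bind> K) B"
      using \<open>space D \<noteq> {}\<close> by (intro emeasure_bind[where N = N, symmetric]) auto
    finally show "emeasure (distr D N Y) B = emeasure (D \<bind> K) B" .
  qed
  then have "(\<integral>\<^sup>+z. g z \<partial>distr D N Y) = (\<integral>\<^sup>+z. g z \<partial>(D \<bind> K))"
    by simp
  then have "(\<integral>\<^sup>+\<omega>. g (Y \<omega>) \<partial>D) = (\<integral>\<^sup>+\<omega>. \<integral>\<^sup>+z. g z \<partial>K \<omega> \<partial>D)"
    by (simp add: nn_integral_distr nn_integral_bind[where B = N])
  then show ?thesis
    unfolding D_def by (simp add: nn_integral_density)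
qed

text \<open>
  Integrability of \<open>g (Y)\<close> on \<open>E\<close> is what permits the passage to signed \<open>g\<close>, by splitting into positive
  and negative parts; realised rewards need be neither bounded nor nonnegative.
\<close>

lemma cond_law_on_integral:
  fixes g :: "'b \<Rightarrow> real"
  assumes "prob_space P" and "subalgebra P F" and "E \<in> sets F" and "E \<subseteq> E'"
    and Y [measurable]: "Y \<in> P \<rightarrow>\<^sub>M N" and K [measurable]: "K \<in> P \<rightarrow>\<^sub>M subprob_algebra N"
    and "\<And>\<omega>. \<omega> \<in> E \<Longrightarrow> \<kappa> \<omega> = K \<omega>"
    and law: "cond_law_on P F E' N Y \<kappa>"
    and g [measurable]: "g \<in> borel_measurable N"
    and int: "integrable P (\<lambda>\<omega>. indicator E \<omega> * g (Y \<omega>))"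
    and intK: "\<And>\<omega>. \<omega> \<in> E \<Longrightarrow> integrable (K \<omega>) g"
  shows "(\<integral>\<omega>. indicator E \<omega> * g (Y \<omega>) \<partial>P) = (\<integral>\<omega>. indicator E \<omega> * (\<integral>z. g z \<partial>K \<omega>) \<partial>P)"
proof -
  have [measurable]: "E \<in> sets P"
    using assms(2,3) by (auto simp: subalgebra_def)
  have half: "integrable P (\<lambda>\<omega>. indicator E \<omega> * (\<integral>z. h z \<partial>K \<omega>)) \<and>
      (\<integral>\<omega>. indicator E \<omega> * h (Y \<omega>) \<partial>P) = (\<integral>\<omega>. indicator E \<omega> * (\<integral>z. h z \<partial>K \<omega>) \<partial>P)"
    if h [measurable]: "h \<in> borel_measurable N" and h0: "\<And>z. 0 \<le> h z"
      and ih: "integrable P (\<lambda>\<omega>. indicator E \<omega> * h (Y \<omega>))"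
      and ihK: "\<And>\<omega>. \<omega> \<in> E \<Longrightarrow> integrable (K \<omega>) h" for h :: "'b \<Rightarrow> real"
  proof -
    have "ennreal (\<integral>\<omega>. indicator E \<omega> * h (Y \<omega>) \<partial>P) = (\<integral>\<^sup>+\<omega>. ennreal (indicator E \<omega> * h (Y \<omega>)) \<partial>P)"
      using h0 by (intro nn_integral_eq_integral[symmetric] ih) auto
    also have "\<dots> = (\<integral>\<^sup>+\<omega>. indicator E \<omega> * ennreal (h (Y \<omega>)) \<partial>P)"
      by (auto intro!: nn_integral_cong simp: indicator_def)
    also have "\<dots> = (\<integral>\<^sup>+\<omega>. indicator E \<omega> * (\<integral>\<^sup>+z. ennreal (h z) \<partial>K \<omega>) \<partial>P)"
      by (rule cond_law_on_nn_integral[OF assms(1-8)]) measurable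
    also have "\<dots> = (\<integral>\<^sup>+\<omega>. ennreal (indicator E \<omega> * (\<integral>z. h z \<partial>K \<omega>)) \<partial>P)"
      using h0 ihK by (intro nn_integral_cong) (auto simp: indicator_def nn_integral_eq_integral)
    finally have eq: "(\<integral>\<^sup>+\<omega>. ennreal (indicator E \<omega> * (\<integral>z. h z \<partial>K \<omega>)) \<partial>P)
        = ennreal (\<integral>\<omega>. indicator E \<omega> * h (Y \<omega>) \<partial>P)" by simp
    have "(\<lambda>\<omega>. \<integral>z. h z \<partial>K \<omega>) \<in> borel_measurable P"
      by (rule measurable_compose[OF K integral_measurable_subprob_algebra]) measurable
    then have m: "(\<lambda>\<omega>. indicator E \<omega> * (\<integral>z. h z \<partial>K \<omega>)) \<in> borel_measurable P"
      by measurable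
    then show ?thesis
      using nn_integral_eq_integrable[OF m, of "\<integral>\<omega>. indicator E \<omega> * h (Y \<omega>) \<partial>P"] h0 eq
      by (auto intro!: integral_nonneg_AE)
  qed
  let ?p = "\<lambda>z. max (g z) 0" and ?n = "\<lambda>z. max (- g z) 0"
  have split: "g z = ?p z - ?n z" for z by auto
  have intP: "integrable P (\<lambda>\<omega>. indicator E \<omega> * ?p (Y \<omega>))" "integrable P (\<lambda>\<omega>. indicator E \<omega> * ?n (Y \<omega>))"
    by (rule Bochner_Integration.integrable_bound[OF int]; force simp: indicator_def)+
  note p = half[OF _ _ intP(1)] and n = half[OF _ _ intP(2)]
  have p': "integrable P (\<lambda>\<omega>. indicator E \<omega> * (\<integral>z. ?p z \<partial>K \<omega>)) \<and>
      (\<integral>\<omega>. indicator E \<omega> * ?p (Y \<omega>) \<partial>P) = (\<integral>\<omega>. indicator E \<omega> * (\<integral>z. ?p z \<partial>K \<omega>) \<partial>P)"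
    using intK by (intro p) auto
  have n': "integrable P (\<lambda>\<omega>. indicator E \<omega> * (\<integral>z. ?n z \<partial>K \<omega>)) \<and>
      (\<integral>\<omega>. indicator E \<omega> * ?n (Y \<omega>) \<partial>P) = (\<integral>\<omega>. indicator E \<omega> * (\<integral>z. ?n z \<partial>K \<omega>) \<partial>P)"
    using intK by (intro n) auto
  have "(\<integral>\<omega>. indicator E \<omega> * g (Y \<omega>) \<partial>P)
      = (\<integral>\<omega>. indicator E \<omega> * ?p (Y \<omega>) - indicator E \<omega> * ?n (Y \<omega>) \<partial>P)"
    by (intro Bochner_Integration.integral_cong) (auto simp: indicator_def)
  also have "\<dots> = (\<integral>\<omega>. indicator E \<omega> * (\<integral>z. ?p z \<partial>K \<omega>) - indicator E \<omega> * (\<integral>z. ?n z \<partial>K \<omega>) \<partial>P)"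
    using p' n' intP by simp
  also have "\<dots> = (\<integral>\<omega>. indicator E \<omega> * (\<integral>z. g z \<partial>K \<omega>) \<partial>P)"
  proof (rule Bochner_Integration.integral_cong[OF refl])
    fix \<omega>
    have "(\<integral>z. ?p z \<partial>K \<omega>) - (\<integral>z. ?n z \<partial>K \<omega>) = (\<integral>z. ?p z - ?n z \<partial>K \<omega>)" if "\<omega> \<in> E"
      using intK[OF that] by (intro Bochner_Integration.integral_diff[symmetric]) auto
    then show "indicator E \<omega> * (\<integral>z. ?p z \<partial>K \<omega>) - indicator E \<omega> * (\<integral>z. ?n z \<partial>K \<omega>)
        = indicator E \<omega> * (\<integral>z. g z \<partial>K \<omega>)"
      by (auto simp: indicator_def split[symmetric])
  qed
  finally show ?thesis .
qed

section \<open>The controlled kernel on information states\<close>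

text \<open>
  The integral that occurs in \<^const>\<open>bellman\<close>.
\<close>

definition next_expectation ::
  "(real ^ 'n) set \<Rightarrow> nat \<Rightarrow> ((nat \<Rightarrow> real ^ 'n) \<Rightarrow> 'u \<Rightarrow> real ^ 'n \<Rightarrow> real)
    \<Rightarrow> ((nat \<Rightarrow> real ^ 'n) \<Rightarrow> real) \<Rightarrow> (nat \<Rightarrow> real ^ 'n) \<Rightarrow> 'u \<Rightarrow> real" where
  "next_expectation X L p J I u = (LINT y:X|lborel. J (next_info L I y) * p I u y)"

text \<open>
  The expected reward at time \<open>k\<close> under the stationary policy \<open>\<pi>\<close>, lost if \<open>X\<close> has been left before, as a
  function of the initial information state; the probabilistic meaning is established in
  \<open>expected_reward\<close> below.
\<close>

primrec stage_reward ::
  "(real ^ 'n) set \<Rightarrow> nat \<Rightarrow> (real ^ 'n \<Rightarrow> 'u \<Rightarrow> real)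
    \<Rightarrow> ((nat \<Rightarrow> real ^ 'n) \<Rightarrow> 'u \<Rightarrow> real ^ 'n \<Rightarrow> real)
    \<Rightarrow> ((nat \<Rightarrow> real ^ 'n) \<Rightarrow> 'u) \<Rightarrow> nat \<Rightarrow> (nat \<Rightarrow> real ^ 'n) \<Rightarrow> real" where
  "stage_reward X L R p \<pi> 0 = (\<lambda>I. R (I 0) (\<pi> I))"
| "stage_reward X L R p \<pi> (Suc k) = (\<lambda>I. next_expectation X L p (stage_reward X L R p \<pi> k) I (\<pi> I))"

locale info_mdp =
  fixes X :: "(real ^ 'n) set" and L :: nat and U :: "'u measure"
    and p :: "(nat \<Rightarrow> real ^ 'n) \<Rightarrow> 'u \<Rightarrow> real ^ 'n \<Rightarrow> real"
    and R :: "real ^ 'n \<Rightarrow> 'u \<Rightarrow> real" and M \<gamma> :: real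
  assumes X_borel [measurable]: "X \<in> sets borel" and X_nonempty: "X \<noteq> {}"
    and density: "info_density X L U p"
    and R_measurable: "(\<lambda>(a, u). R a u) \<in> borel_measurable (restrict_space borel X \<Otimes>\<^sub>M U)"
    and R_bounds: "\<And>a u. a \<in> X \<Longrightarrow> u \<in> space U \<Longrightarrow> R a u \<in> {0..M}"
    and discount: "0 \<le> \<gamma>" "\<gamma> < 1"
begin

abbreviation "states \<equiv> info_states X L"
abbreviation "nexp \<equiv> next_expectation X L p"

lemma density_nonneg: "I \<in> states \<Longrightarrow> u \<in> space U \<Longrightarrow> 0 \<le> p I u y"
  using density by (auto simp: info_density_def prob_density_def)

lemma density_measurable: "I \<in> states \<Longrightarrow> u \<in> space U \<Longrightarrow> p I u \<in> borel_measurable borel"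
  using density by (auto simp: info_density_def prob_density_def)

lemma density_total: "I \<in> states \<Longrightarrow> u \<in> space U \<Longrightarrow> (\<integral>\<^sup>+y. ennreal (p I u y) \<partial>lborel) = 1"
  using density by (auto simp: info_density_def prob_density_def)

lemma density_integrable: "I \<in> states \<Longrightarrow> u \<in> space U \<Longrightarrow> integrable lborel (p I u)"
  using density_measurable[of I u] density_nonneg[of I u] density_total[of I u]
  by (intro integrableI_nonneg) auto

lemma density_integral: "I \<in> states \<Longrightarrow> u \<in> space U \<Longrightarrow> (\<integral>y. p I u y \<partial>lborel) = 1"
  using density_measurable[of I u] density_nonneg[of I u] density_total[of I u]
  by (subst integral_eq_nn_integral) auto

lemma next_info_in_states: "I \<in> states \<Longrightarrow> y \<in> X \<Longrightarrow> next_info L I y \<in> states"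
  by (auto simp: info_states_def next_info_def PiE_iff)

lemma next_info_in_states_iff: "I \<in> states \<Longrightarrow> next_info L I y \<in> states \<longleftrightarrow> y \<in> X"
  by (auto simp: info_states_def next_info_def PiE_iff split: if_splits)

lemma policy_action: "\<pi> \<in> policies X L U \<Longrightarrow> I \<in> states \<Longrightarrow> \<pi> I \<in> space U"
  by (auto simp: policies_def space_info_space[symmetric] dest: measurable_space)

lemma states_nonempty: "states \<noteq> {}"
  using X_nonempty by (auto simp: info_states_def PiE_eq_empty_iff)

text \<open>
  Policies and value functions live on \<^const>\<open>info_states\<close>, whereas trajectories may leave \<open>X\<close>.
  Composing with this measurable retraction onto the information states makes every function involved
  total and measurable, without changing it where it matters.
\<close>

definition retract :: "(nat \<Rightarrow> real ^ 'n) \<Rightarrow> (nat \<Rightarrow> real ^ 'n)" where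
  "retract J = (if J \<in> states then J else (SOME I. I \<in> states))"

lemma retract_in_states: "retract J \<in> states"
  using states_nonempty by (simp add: retract_def some_in_eq)

lemma retract_id: "J \<in> states \<Longrightarrow> retract J = J"
  by (simp add: retract_def)

lemma states_measurable [measurable]: "states \<in> sets (\<Pi>\<^sub>M j\<in>{..L}. borel)"
  unfolding info_states_def by (intro sets_PiM_I_finite) auto

lemma retract_measurable [measurable]:
  "retract \<in> (\<Pi>\<^sub>M j\<in>{..L}. borel) \<rightarrow>\<^sub>M info_space X L"
  unfolding info_space_def
proof (rule measurable_PiM_single')
  fix j assume j [measurable]: "j \<in> {..L}"
  have "(\<lambda>J. retract J j) \<in> (\<Pi>\<^sub>M j\<in>{..L}. borel) \<rightarrow>\<^sub>M borel"
    unfolding retract_def if_distrib[of "\<lambda>J. J j"] by measurable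
  then show "(\<lambda>J. retract J j) \<in> (\<Pi>\<^sub>M j\<in>{..L}. borel) \<rightarrow>\<^sub>M restrict_space borel X"
    using retract_in_states j by (intro measurable_restrict_space2) (auto simp: info_states_def)
next
  show "retract \<in> space (\<Pi>\<^sub>M j\<in>{..L}. borel) \<rightarrow> (\<Pi>\<^sub>E j\<in>{..L}. space (restrict_space borel X))"
    using retract_in_states by (auto simp: info_states_def space_restrict_space)
qed

lemma next_info_measurable [measurable]:
  "(\<lambda>(I, y). next_info L I y) \<in> info_space X L \<Otimes>\<^sub>M borel \<rightarrow>\<^sub>M (\<Pi>\<^sub>M j\<in>{..L}. borel)"
proof -
  have comp: "(\<lambda>I. I j) \<in> info_space X L \<rightarrow>\<^sub>M borel" if "j \<le> L" for j
  proof -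
    have "(\<lambda>I. I j) \<in> info_space X L \<rightarrow>\<^sub>M restrict_space borel X"
      unfolding info_space_def using that by (intro measurable_component_singleton) auto
    then show ?thesis
      by (rule measurable_restrict_space2_iff[THEN iffD1, THEN conjunct1])
  qed
  show ?thesis
    unfolding next_info_def split_beta
  proof (rule measurable_restrict)
    fix j assume "j \<in> {..L}"
    then have [measurable]: "(\<lambda>I. I (j - 1)) \<in> info_space X L \<rightarrow>\<^sub>M borel"
      by (intro comp) auto
    show "(\<lambda>z. if j = 0 then snd z else fst z (j - 1)) \<in> info_space X L \<Otimes>\<^sub>M borel \<rightarrow>\<^sub>M borel"
      by measurable
  qed
qed

lemma next_info_measurable2: "I \<in> states \<Longrightarrow> next_info L I \<in> borel \<rightarrow>\<^sub>M (\<Pi>\<^sub>M j\<in>{..L}. borel)"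
  using measurable_Pair2[OF next_info_measurable] by (simp add: space_info_space)

lemma density_policy_measurable:
  assumes [measurable]: "\<pi> \<in> policies X L U"
  shows "(\<lambda>(I, y). p I (\<pi> I) y) \<in> borel_measurable (info_space X L \<Otimes>\<^sub>M borel)"
proof -
  have [measurable]: "\<pi> \<in> info_space X L \<rightarrow>\<^sub>M U"
    using assms by (simp add: policies_def)
  have "(\<lambda>z. ((fst z, \<pi> (fst z)), snd z))
      \<in> info_space X L \<Otimes>\<^sub>M borel \<rightarrow>\<^sub>M (info_space X L \<Otimes>\<^sub>M U) \<Otimes>\<^sub>M borel"
    by measurable
  from measurable_compose[OF this, of "\<lambda>((I, u), y). p I u y" borel] density show ?thesis
    by (simp add: info_density_def split_beta)
qed

lemma nexp_retract:
  assumes "I \<in> states"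
  shows "nexp J I u = (LINT y|lborel. indicator X y * J (retract (next_info L I y)) * p I u y)"
  unfolding next_expectation_def set_lebesgue_integral_def
  using next_info_in_states[OF assms]
  by (intro Bochner_Integration.integral_cong) (auto simp: indicator_def retract_id)

lemma nexp_integrable:
  assumes [measurable]: "J \<in> borel_measurable (info_space X L)"
    and "\<And>I. I \<in> states \<Longrightarrow> \<bar>J I\<bar> \<le> C" and I: "I \<in> states" and u: "u \<in> space U"
  shows "integrable lborel (\<lambda>y. indicator X y * J (retract (next_info L I y)) * p I u y)"
proof (rule Bochner_Integration.integrable_bound)
  note [measurable] = next_info_measurable2[OF I] density_measurable[OF I u]
  show "integrable lborel (\<lambda>y. C * p I u y)"
    using density_integrable[OF I u] by simp
  show "(\<lambda>y. indicator X y * J (retract (next_info L I y)) * p I u y) \<in> borel_measurable lborel"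
    by measurable
  have "\<bar>indicator X y * J (retract (next_info L I y))\<bar> * p I u y \<le> \<bar>C\<bar> * p I u y" for y
    using assms(2)[OF retract_in_states, of "next_info L I y"] density_nonneg[OF I u]
    by (intro mult_right_mono) (auto simp: indicator_def)
  then show "AE y in lborel. norm (indicator X y * J (retract (next_info L I y)) * p I u y) \<le> norm (C * p I u y)"
    using density_nonneg[OF I u] by (auto simp: abs_mult)
qed

text \<open>
  The one-step operator does not expand distances in the supremum norm, since \<open>p I u\<close> has mass at most one
  on \<open>X\<close>.
\<close>

lemma nexp_diff_le:
  assumes J: "J \<in> borel_measurable (info_space X L)" "\<And>I. I \<in> states \<Longrightarrow> \<bar>J I\<bar> \<le> C"
    and J': "J' \<in> borel_measurable (info_space X L)" "\<And>I. I \<in> states \<Longrightarrow> \<bar>J' I\<bar> \<le> C'"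
    and c: "\<And>I. I \<in> states \<Longrightarrow> \<bar>J I - J' I\<bar> \<le> c" and I: "I \<in> states" and u: "u \<in> space U"
  shows "\<bar>nexp J I u - nexp J' I u\<bar> \<le> c"
proof -
  let ?f = "\<lambda>J y. indicator X y * J (retract (next_info L I y)) * p I u y"
  note int = nexp_integrable[OF J I u] nexp_integrable[OF J' I u]
  have "nexp J I u - nexp J' I u = (LINT y|lborel. ?f J y - ?f J' y)"
    using int by (simp add: nexp_retract[OF I])
  then have "\<bar>nexp J I u - nexp J' I u\<bar> = \<bar>LINT y|lborel. ?f J y - ?f J' y\<bar>"
    by simp
  also have "\<dots> \<le> (LINT y|lborel. \<bar>?f J y - ?f J' y\<bar>)"
    by (rule integral_abs_bound)
  also have "\<dots> \<le> (LINT y|lborel. c * p I u y)"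
  proof (rule integral_mono)
    show "integrable lborel (\<lambda>y. \<bar>?f J y - ?f J' y\<bar>)"
      using int by auto
    show "integrable lborel (\<lambda>y. c * p I u y)"
      using density_integrable[OF I u] by simp
    fix y
    have "0 \<le> c"
      using c[OF I] by (rule order_trans[OF abs_ge_zero])
    have "\<bar>?f J y - ?f J' y\<bar> = indicator X y * \<bar>J (retract (next_info L I y)) - J' (retract (next_info L I y))\<bar> * p I u y"
      using density_nonneg[OF I u, of y] by (auto simp: indicator_def abs_mult left_diff_distrib[symmetric])
    also have "\<dots> \<le> c * p I u y"
      using density_nonneg[OF I u, of y] c[OF retract_in_states, of "next_info L I y"] \<open>0 \<le> c\<close>
      by (intro mult_right_mono) (auto simp: indicator_def)
    finally show "\<bar>?f J y - ?f J' y\<bar> \<le> c * p I u y" .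
  qed
  also have "\<dots> = c"
    using density_integral[OF I u] by simp
  finally show ?thesis .
qed

lemma nexp_bounds:
  assumes J: "J \<in> borel_measurable (info_space X L)" "\<And>I. I \<in> states \<Longrightarrow> J I \<in> {0..C}"
    and I: "I \<in> states" and u: "u \<in> space U"
  shows "nexp J I u \<in> {0..C}"
proof -
  have "0 \<le> nexp J I u"
    unfolding nexp_retract[OF I]
    using J(2)[OF retract_in_states] density_nonneg[OF I u] by (intro integral_nonneg_AE) auto
  moreover have "\<bar>nexp J I u - nexp (\<lambda>_. 0) I u\<bar> \<le> C"
    by (rule nexp_diff_le[where C = C and C' = 0]) (use assms in auto)
  ultimately show ?thesis
    by (simp add: next_expectation_def set_lebesgue_integral_def)
qed

lemma nexp_measurable:
  assumes [measurable]: "J \<in> borel_measurable (info_space X L)" and \<pi>: "\<pi> \<in> policies X L U"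
  shows "(\<lambda>I. nexp J I (\<pi> I)) \<in> borel_measurable (info_space X L)"
proof -
  note [measurable] = density_policy_measurable[OF \<pi>]
  have "(\<lambda>I. LINT y|lborel. indicator X y * J (retract (next_info L I y)) * p I (\<pi> I) y)
      \<in> borel_measurable (info_space X L)"
    by measurable
  then show ?thesis
    by (rule measurable_cong[THEN iffD2, rotated]) (simp add: nexp_retract space_info_space)
qed

abbreviation "stage \<equiv> stage_reward X L R p"

lemma stage_measurable [measurable]:
  assumes "\<pi> \<in> policies X L U"
  shows "stage \<pi> k \<in> borel_measurable (info_space X L)"
proof (induction k)
  case 0
  have [measurable]: "\<pi> \<in> info_space X L \<rightarrow>\<^sub>M U" "(\<lambda>I. I 0) \<in> info_space X L \<rightarrow>\<^sub>M restrict_space borel X"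
    using assms by (auto simp: policies_def info_space_def)
  have "(\<lambda>I. (I 0, \<pi> I)) \<in> info_space X L \<rightarrow>\<^sub>M restrict_space borel X \<Otimes>\<^sub>M U"
    by measurable
  from measurable_compose[OF this R_measurable] show ?case
    by simp
qed (use nexp_measurable[OF _ assms] in simp)

lemma stage_bounds: "\<pi> \<in> policies X L U \<Longrightarrow> I \<in> states \<Longrightarrow> stage \<pi> k I \<in> {0..M}"
proof (induction k arbitrary: I)
  case 0
  then show ?case
    using R_bounds[of "I 0" "\<pi> I"] policy_action by (auto simp: info_states_def)
next
  case (Suc k)
  show ?case
    unfolding stage_reward.simps
    by (intro nexp_bounds stage_measurable Suc policy_action)
qed

text \<open>
  The conditional law of the next information vector, which may lie outside \<^const>\<open>info_states\<close>.
\<close>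

definition transition ::
  "((nat \<Rightarrow> real ^ 'n) \<Rightarrow> 'u) \<Rightarrow> (nat \<Rightarrow> real ^ 'n) \<Rightarrow> (nat \<Rightarrow> real ^ 'n) measure" where
  "transition \<pi> I =
     distr (density lborel (\<lambda>y. ennreal (p I (\<pi> I) y))) (\<Pi>\<^sub>M j\<in>{..L}. borel) (next_info L I)"

lemma density_prob_space:
  assumes "I \<in> states" "u \<in> space U"
  shows "prob_space (density lborel (\<lambda>y. ennreal (p I u y)))"
  using density_measurable[OF assms] density_total[OF assms]
  by (intro prob_spaceI) (simp add: emeasure_density)

lemma transition_measurable:
  assumes \<pi>: "\<pi> \<in> policies X L U"
  shows "transition \<pi> \<in> info_space X L \<rightarrow>\<^sub>M subprob_algebra (\<Pi>\<^sub>M j\<in>{..L}. borel)"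
  unfolding transition_def
proof (rule measurable_distr2)
  show "case_prod (next_info L) \<in> info_space X L \<Otimes>\<^sub>M borel \<rightarrow>\<^sub>M (\<Pi>\<^sub>M j\<in>{..L}. borel)"
    by measurable
  show "(\<lambda>I. density lborel (\<lambda>y. ennreal (p I (\<pi> I) y))) \<in> info_space X L \<rightarrow>\<^sub>M subprob_algebra borel"
  proof (rule measurable_subprob_algebra)
    fix I assume "I \<in> space (info_space X L)"
    then show "subprob_space (density lborel (\<lambda>y. ennreal (p I (\<pi> I) y)))"
      using policy_action[OF \<pi>]
      by (intro prob_space_imp_subprob_space density_prob_space) (auto simp: space_info_space)
  next
    fix A :: "(real ^ 'n) set" assume [measurable]: "A \<in> sets borel"
    note [measurable] = density_policy_measurable[OF \<pi>]
    have "(\<lambda>I. \<integral>\<^sup>+y. ennreal (p I (\<pi> I) y) * indicator A y \<partial>lborel) \<in> borel_measurable (info_space X L)"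
      by measurable
    then show "(\<lambda>I. emeasure (density lborel (\<lambda>y. ennreal (p I (\<pi> I) y))) A)
        \<in> borel_measurable (info_space X L)"
      by (rule measurable_cong[THEN iffD2, rotated])
         (use policy_action[OF \<pi>] density_measurable in \<open>auto simp: space_info_space emeasure_density\<close>)
  qed simp
qed

lemma transition_integral:
  assumes [measurable]: "J \<in> borel_measurable (info_space X L)"
    and \<pi>: "\<pi> \<in> policies X L U" and I: "I \<in> states"
  shows "(\<integral>H. indicator states H * J (retract H) \<partial>transition \<pi> I) = nexp J I (\<pi> I)"
proof -
  note u = policy_action[OF \<pi> I]
  note [measurable] = next_info_measurable2[OF I] density_measurable[OF I u]
  have "(\<integral>H. indicator states H * J (retract H) \<partial>transition \<pi> I)
      = (LINT y|lborel. p I (\<pi> I) y * (indicator states (next_info L I y) * J (retract (next_info L I y))))"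
    unfolding transition_def using density_nonneg[OF I u]
    by (simp add: integral_distr integral_density)
  also have "\<dots> = nexp J I (\<pi> I)"
    unfolding nexp_retract[OF I]
    by (intro Bochner_Integration.integral_cong)
       (auto simp: indicator_def next_info_in_states_iff[OF I])
  finally show ?thesis .
qed

end

section \<open>Trajectories\<close>

text \<open>
  The offset \<open>-1\<close> in \<^const>\<open>stop_time\<close>: the reward at time \<open>k\<close> is collected iff the first exit occurs
  at \<open>k + 1\<close> or later.
\<close>

lemma le_stop_time_iff:
  "ereal (real k) \<le> stop_time X x \<omega> \<longleftrightarrow> (\<forall>i\<le>k. x (int i) \<omega> \<in> X)"
proof -
  have "ereal (real k) \<le> stop_time X x \<omega>
      \<longleftrightarrow> ereal (real k) + 1 \<le> (INF i\<in>{i::nat. x (int i) \<omega> \<notin> X}. ereal (real i))"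
    unfolding stop_time_def by (subst ereal_le_minus) auto
  also have "\<dots> \<longleftrightarrow> (\<forall>i. x (int i) \<omega> \<notin> X \<longrightarrow> Suc k \<le> i)"
    unfolding le_INF_iff by (auto simp: one_ereal_def)
  finally show ?thesis
    by (meson not_less_eq_eq)
qed

locale info_trajectory = info_mdp X L U p "mean_reward \<rho>" M \<gamma>
  for X :: "(real ^ 'n) set" and L and U :: "'u measure" and p \<rho> M \<gamma> +
  fixes S :: "'s set" and px ps
    and x :: "int \<Rightarrow> 'w \<Rightarrow> real ^ 'n" and s :: "nat \<Rightarrow> 'w \<Rightarrow> 's" and r :: "nat \<Rightarrow> 'w \<Rightarrow> real"
    and \<pi> :: "(nat \<Rightarrow> real ^ 'n) \<Rightarrow> 'u" and I :: "nat \<Rightarrow> real ^ 'n" and P :: "'w measure"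
  assumes policy: "\<pi> \<in> policies X L U" and initial: "I \<in> info_states X L"
    and rewards: "reward_kernel X U \<rho>"
    and process: "controlled_process X S L px ps \<rho> x s r \<pi> I P"
    and markov: "markov_info X L p x \<pi> P"
    and summable_rewards: "reward_sum_integrable X \<gamma> x r P"
begin

text \<open>
  Like \<^const>\<open>alive\<close>, but including the observations before time \<open>0\<close>, so that the information vectors at
  times \<open>0, \<dots>, k\<close> are all information states. The two events differ by a null set only, because the
  initial information state is almost surely \<open>I\<close>.
\<close>

definition survive :: "nat \<Rightarrow> 'w set" where
  "survive k = {\<omega> \<in> space P. \<forall>i\<in>{- int L..int k}. x i \<omega> \<in> X}"

definition info :: "nat \<Rightarrow> 'w \<Rightarrow> (nat \<Rightarrow> real ^ 'n)" where
  "info k \<omega> = retract (info_at L x k \<omega>)"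

sublocale prob_space P
  using process by (simp add: controlled_process_def)

lemma x_measurable: "- int L \<le> i \<Longrightarrow> x i \<in> borel_measurable P"
  using process by (simp add: controlled_process_def)

lemma s_measurable [measurable]: "s k \<in> P \<rightarrow>\<^sub>M count_space S"
  using process by (simp add: controlled_process_def)

lemma r_measurable [measurable]: "r k \<in> borel_measurable P"
  using process by (simp add: controlled_process_def)

lemma info_at_measurable [measurable]: "info_at L x k \<in> P \<rightarrow>\<^sub>M (\<Pi>\<^sub>M j\<in>{..L}. borel)"
  unfolding info_at_def by (intro measurable_restrict x_measurable) auto

lemma info_measurable [measurable]: "info k \<in> P \<rightarrow>\<^sub>M info_space X L"
  unfolding info_def by measurable

lemma info_in_states: "info k \<omega> \<in> states"
  by (simp add: info_def retract_in_states)

lemma info_survive: "\<omega> \<in> survive k \<Longrightarrow> info k \<omega> = info_at L x k \<omega>"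
  unfolding info_def by (rule retract_id) (auto simp: survive_def info_at_def info_states_def)

lemma survive_Suc: "survive (Suc k) = {\<omega> \<in> survive k. info_at L x (Suc k) \<omega> \<in> states}"
proof -
  have "info_at L x (Suc k) \<omega> \<in> states \<longleftrightarrow> (\<forall>j\<le>L. x (int (Suc k) - int j) \<omega> \<in> X)" for \<omega>
    by (auto simp: info_at_def info_states_def PiE_iff)
  moreover have "(\<forall>i\<in>{- int L..int (Suc k)}. Q i)
      \<longleftrightarrow> (\<forall>i\<in>{- int L..int k}. Q i) \<and> (\<forall>j\<le>L. Q (int (Suc k) - int j))" for Q
  proof (intro iffI conjI ballI allI impI)
    fix i assume Q: "(\<forall>i\<in>{- int L..int k}. Q i) \<and> (\<forall>j\<le>L. Q (int (Suc k) - int j))"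
      and i: "i \<in> {- int L..int (Suc k)}"
    show "Q i"
    proof (cases "i = int (Suc k)")
      case True
      then show ?thesis using Q[THEN conjunct2, rule_format, of 0] by simp
    qed (use Q i in auto)
  qed auto
  ultimately show ?thesis
    by (auto simp: survive_def)
qed

lemma survive_sets_of:
  assumes "space F = space P" "\<And>i. i \<in> {- int L..int k} \<Longrightarrow> x i \<in> borel_measurable F"
  shows "survive k \<in> sets F"
  unfolding survive_def assms(1)[symmetric]
proof (rule sets.sets_Collect_finite_All')
  fix i assume "i \<in> {- int L..int k}"
  from measurable_sets[OF assms(2)[OF this] X_borel]
  show "{\<omega> \<in> space F. x i \<omega> \<in> X} \<in> sets F"
    by (simp add: vimage_def Int_def conj_commute)
qed auto

lemma survive_sets [measurable]: "survive k \<in> sets P"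
  by (intro survive_sets_of x_measurable) auto

lemma state_history_subalgebra: "subalgebra P (state_history P S L x s k)"
  unfolding subalgebra_def state_history_def
  by (intro conjI sets_image_in_sets measurable_Pair measurable_restrict)
     (auto intro: x_measurable)

lemma survive_state_history: "survive k \<in> sets (state_history P S L x s k)"
proof (rule survive_sets_of)
  fix i assume i: "i \<in> {- int L..int k}"
  let ?N = "(\<Pi>\<^sub>M i\<in>{- int L..int k}. borel) \<Otimes>\<^sub>M (\<Pi>\<^sub>M i\<in>{..k}. count_space S)"
  let ?h = "\<lambda>\<omega>. (\<lambda>i\<in>{- int L..int k}. x i \<omega>, \<lambda>i\<in>{..k}. s i \<omega>)"
  have h: "?h \<in> state_history P S L x s k \<rightarrow>\<^sub>M ?N"
    unfolding state_history_def using measurable_space[OF s_measurable]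
    by (intro measurable_vimage_algebra1) (auto simp: space_pair_measure space_PiM)
  have "(\<lambda>z. fst z i) \<in> ?N \<rightarrow>\<^sub>M borel"
    by (rule measurable_compose[OF measurable_fst measurable_component_singleton[OF i]])
  from measurable_compose[OF h this] i show "x i \<in> borel_measurable (state_history P S L x s k)"
    by simp
qed (simp add: state_history_def)

lemma info_history_subalgebra: "subalgebra P (info_history P L x k)"
  unfolding subalgebra_def info_history_def
  by (intro conjI sets_image_in_sets measurable_restrict) auto

text \<open>
  Every index \<open>i\<close> from \<open>-L\<close> to \<open>k\<close> is of the form \<open>a - b\<close> with \<open>a \<le> k\<close> and \<open>b \<le> L\<close>, so the
  observation \<open>x(i)\<close> is a component of one of \<open>I(0), \<dots>, I(k)\<close>.
\<close>

lemma survive_info_history: "survive k \<in> sets (info_history P L x k)"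
proof (rule survive_sets_of)
  fix i assume i: "i \<in> {- int L..int k}"
  let ?N = "\<Pi>\<^sub>M i\<in>{..k}. \<Pi>\<^sub>M j\<in>{..L}. borel"
  have h: "(\<lambda>\<omega>. \<lambda>i\<in>{..k}. info_at L x i \<omega>) \<in> info_history P L x k \<rightarrow>\<^sub>M ?N"
    unfolding info_history_def
    by (intro measurable_vimage_algebra1) (auto simp: space_PiM info_at_def)
  define a where "a = nat i"
  define b where "b = nat (int a - i)"
  have ab: "a \<in> {..k}" "b \<in> {..L}" "int a - int b = i"
    using i by (auto simp: a_def b_def)
  have "(\<lambda>z. z a b) \<in> ?N \<rightarrow>\<^sub>M borel"
    by (rule measurable_compose[OF measurable_component_singleton[OF ab(1)] measurable_component_singleton[OF ab(2)]])
  from measurable_compose[OF h this] ab show "x i \<in> borel_measurable (info_history P L x k)"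
    by (simp add: info_at_def)
qed (simp add: info_history_def)

lemma survive_alive: "survive k \<subseteq> alive P X x k"
  by (auto simp: survive_def alive_def le_stop_time_iff)

lemma AE_initial: "AE \<omega> in P. info_at L x 0 \<omega> = I"
  using process by (simp add: controlled_process_def)

lemma AE_survive_iff: "AE \<omega> in P. \<omega> \<in> survive k \<longleftrightarrow> ereal (real k) \<le> stop_time X x \<omega>"
  using AE_initial AE_space
proof eventually_elim
  case (elim \<omega>)
  have past: "x (- int j) \<omega> \<in> X" if "j \<le> L" for j
    using initial fun_cong[OF elim(1), of j] that by (auto simp: info_at_def info_states_def PiE_iff)
  show ?case
    unfolding le_stop_time_iff
  proof
    assume "\<forall>i\<le>k. x (int i) \<omega> \<in> X"
    moreover have "i = int (nat i) \<or> i = - int (nat (- i))" for i by auto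
    ultimately show "\<omega> \<in> survive k"
      using past elim(2) unfolding survive_def
      by (smt (verit) atLeastAtMost_iff int_nat_eq mem_Collect_eq nat_le_iff zle_int)
  qed (auto simp: survive_def)
qed

definition surviving_mean :: "nat \<Rightarrow> ((nat \<Rightarrow> real ^ 'n) \<Rightarrow> real) \<Rightarrow> real" where
  "surviving_mean k J = (\<integral>\<omega>. indicator (survive k) \<omega> * J (info k \<omega>) \<partial>P)"

text \<open>
  The Markov property in integrated form: surviving until \<open>k + 1\<close> means surviving until \<open>k\<close> and moving to
  an information state, and the first of these events is known at time \<open>k\<close>.
\<close>

lemma surviving_mean_Suc:
  assumes [measurable]: "J \<in> borel_measurable (info_space X L)"
    and J: "\<And>H. H \<in> states \<Longrightarrow> J H \<in> {0..C}"
  shows "surviving_mean (Suc k) J = surviving_mean k (\<lambda>H. nexp J H (\<pi> H))"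
proof -
  let ?g = "\<lambda>H. indicator states H * J (retract H)"
  have bound: "norm (?g H) \<le> C" for H
    using J[OF retract_in_states, of H] by (auto simp: indicator_def)
  have trans [measurable]: "(\<lambda>\<omega>. transition \<pi> (info k \<omega>)) \<in> P \<rightarrow>\<^sub>M subprob_algebra (\<Pi>\<^sub>M j\<in>{..L}. borel)"
    by (rule measurable_compose[OF info_measurable transition_measurable[OF policy]])
  have "surviving_mean (Suc k) J = (\<integral>\<omega>. indicator (survive k) \<omega> * ?g (info_at L x (Suc k) \<omega>) \<partial>P)"
    unfolding surviving_mean_def
    by (intro Bochner_Integration.integral_cong)
       (auto simp: survive_Suc info_def indicator_def)
  also have "\<dots> = (\<integral>\<omega>. indicator (survive k) \<omega> * (\<integral>H. ?g H \<partial>transition \<pi> (info k \<omega>)) \<partial>P)"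
  proof (rule cond_law_on_integral[OF _ info_history_subalgebra survive_info_history survive_alive])
    show "cond_law_on P (info_history P L x k) (alive P X x k) (\<Pi>\<^sub>M j\<in>{..L}. borel) (info_at L x (Suc k))
        (\<lambda>\<omega>. transition \<pi> (info_at L x k \<omega>))"
      using markov by (simp add: markov_info_def transition_def)
    have "norm (indicator (survive k) \<omega> * ?g (info_at L x (Suc k) \<omega>)) \<le> C" for \<omega>
      using bound[of "info_at L x (Suc k) \<omega>"] J[OF retract_in_states, of undefined]
      by (auto simp: indicator_def)
    then show "integrable P (\<lambda>\<omega>. indicator (survive k) \<omega> * ?g (info_at L x (Suc k) \<omega>))"
      by (intro integrable_const_bound[of _ C]) auto
    fix \<omega>
    have "transition \<pi> (info k \<omega>) \<in> space (subprob_algebra (\<Pi>\<^sub>M j\<in>{..L}. borel))"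
      using info_in_states by (intro measurable_space[OF transition_measurable[OF policy]]) (simp add: space_info_space)
    then interpret T: subprob_space "transition \<pi> (info k \<omega>)"
      by (simp add: space_subprob_algebra)
    have sets: "sets (transition \<pi> (info k \<omega>)) = sets (\<Pi>\<^sub>M j\<in>{..L}. borel)"
      by (simp add: transition_def)
    show "integrable (transition \<pi> (info k \<omega>)) ?g"
      using bound by (intro T.integrable_const_bound[of _ C]) (auto simp: measurable_cong_sets[OF sets refl])
  qed (auto simp: prob_space_axioms info_survive)
  also have "\<dots> = surviving_mean k (\<lambda>H. nexp J H (\<pi> H))"
    unfolding surviving_mean_def by (simp add: transition_integral policy info_in_states)
  finally show ?thesis .
qed

lemma surviving_mean_0:
  assumes [measurable]: "J \<in> borel_measurable (info_space X L)"
  shows "surviving_mean 0 J = J I"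
proof -
  have "surviving_mean 0 J = (\<integral>\<omega>. J I \<partial>P)"
    unfolding surviving_mean_def
  proof (rule integral_cong_AE)
    show "AE \<omega> in P. indicator (survive 0) \<omega> * J (info 0 \<omega>) = J I"
      using AE_initial AE_survive_iff[of 0]
    proof eventually_elim
      case (elim \<omega>)
      have "x 0 \<omega> = info_at L x 0 \<omega> 0"
        by (simp add: info_at_def)
      then have "\<omega> \<in> survive 0"
        using elim initial le_stop_time_iff[of 0 X x \<omega>] by (auto simp: info_states_def)
      then show ?case
        using elim(1) by (simp add: info_survive)
    qed
  qed measurable
  then show ?thesis by (simp add: prob_space)
qed

lemma surviving_mean_stage: "surviving_mean k (stage \<pi> j) = stage \<pi> (k + j) I"
proof (induction k arbitrary: j)
  case (Suc k)
  show ?case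
    using surviving_mean_Suc[OF stage_measurable[OF policy] stage_bounds[OF policy], of k j] Suc[of "Suc j"]
    by simp
qed (simp add: surviving_mean_0 stage_measurable[OF policy])

text \<open>
  Conditionally on the state history the reward has mean \<open>mean_reward \<rho> (x(k)) (\<pi>(I(k)))\<close>, a
  function of the information state, which is then pulled back to time \<open>0\<close>.
\<close>

lemma expected_reward:
  assumes "integrable P (\<lambda>\<omega>. indicator (survive k) \<omega> * r k \<omega>)"
  shows "(\<integral>\<omega>. indicator (survive k) \<omega> * r k \<omega> \<partial>P) = stage \<pi> k I"
proof -
  have pol [measurable]: "\<pi> \<in> info_space X L \<rightarrow>\<^sub>M U" "(\<lambda>H. H 0) \<in> info_space X L \<rightarrow>\<^sub>M restrict_space borel X"
    using policy by (auto simp: policies_def info_space_def)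
  have "(\<lambda>\<omega>. (info k \<omega> 0, \<pi> (info k \<omega>))) \<in> P \<rightarrow>\<^sub>M restrict_space borel X \<Otimes>\<^sub>M U"
    by (intro measurable_Pair measurable_compose[OF info_measurable] pol)
  moreover have "(\<lambda>(a, u). \<rho> a u) \<in> restrict_space borel X \<Otimes>\<^sub>M U \<rightarrow>\<^sub>M subprob_algebra borel"
    using rewards by (auto simp: reward_kernel_def intro: measurable_prob_algebraD)
  ultimately have K: "(\<lambda>\<omega>. \<rho> (info k \<omega> 0) (\<pi> (info k \<omega>))) \<in> P \<rightarrow>\<^sub>M subprob_algebra borel"
    by (auto dest: measurable_compose)
  have "(\<integral>\<omega>. indicator (survive k) \<omega> * r k \<omega> \<partial>P)
      = (\<integral>\<omega>. indicator (survive k) \<omega> * (\<integral>z. z \<partial>\<rho> (info k \<omega> 0) (\<pi> (info k \<omega>))) \<partial>P)"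
  proof (rule cond_law_on_integral[OF _ state_history_subalgebra survive_state_history survive_alive _ K])
    show "cond_law_on P (state_history P S L x s k) (alive P X x k) borel (r k)
        (\<lambda>\<omega>. \<rho> (x (int k) \<omega>) (\<pi> (info_at L x k \<omega>)))"
      using process by (simp add: controlled_process_def)
    show "\<rho> (x (int k) \<omega>) (\<pi> (info_at L x k \<omega>)) = \<rho> (info k \<omega> 0) (\<pi> (info k \<omega>))" if "\<omega> \<in> survive k" for \<omega>
      using that by (simp add: info_survive) (simp add: info_at_def)
    fix \<omega>
    have "info k \<omega> 0 \<in> X" "\<pi> (info k \<omega>) \<in> space U"
      using info_in_states[of k \<omega>] policy_action[OF policy] by (auto simp: info_states_def)
    then show "integrable (\<rho> (info k \<omega> 0) (\<pi> (info k \<omega>))) (\<lambda>z. z)"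
      using rewards by (simp add: reward_kernel_def)
  qed (use assms prob_space_axioms in auto)
  also have "\<dots> = surviving_mean k (stage \<pi> 0)"
    by (simp add: surviving_mean_def mean_reward_def)
  finally show ?thesis
    by (simp add: surviving_mean_stage del: stage_reward.simps)
qed

text \<open>
  Expectation and sum are interchanged by absolute convergence, which is the content of
  \<^const>\<open>reward_sum_integrable\<close>.
\<close>

lemma expected_discounted_reward:
  "(\<lambda>k. \<gamma> ^ k * stage \<pi> k I) sums
     (\<integral>\<omega>. (\<Sum>k. if ereal (real k) \<le> stop_time X x \<omega> then \<gamma> ^ k * r k \<omega> else 0) \<partial>P)"
proof -
  let ?f = "\<lambda>k \<omega>. if ereal (real k) \<le> stop_time X x \<omega> then \<gamma> ^ k * r k \<omega> else 0"
  let ?g = "\<lambda>k \<omega>. \<gamma> ^ k * (indicator (survive k) \<omega> * r k \<omega>)"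
  have fg: "AE \<omega> in P. \<forall>k. ?f k \<omega> = ?g k \<omega>"
    unfolding AE_all_countable
  proof
    fix k
    show "AE \<omega> in P. ?f k \<omega> = ?g k \<omega>"
      using AE_survive_iff[of k] by eventually_elim (auto simp: indicator_def)
  qed
  have [measurable]: "?f k \<in> borel_measurable P" for k
  proof -
    have [measurable]: "x (int i) \<in> borel_measurable P" for i
      by (rule x_measurable) simp
    show ?thesis
      unfolding le_stop_time_iff by measurable
  qed
  have norm_f: "ennreal (norm (?f k \<omega>))
      = (if ereal (real k) \<le> stop_time X x \<omega> then ennreal (\<gamma> ^ k * \<bar>r k \<omega>\<bar>) else 0)" for k \<omega>
    using discount by (simp add: abs_mult)
  have "(\<integral>\<^sup>+\<omega>. (\<Sum>k. ennreal (norm (?g k \<omega>))) \<partial>P) = (\<integral>\<^sup>+\<omega>. (\<Sum>k. ennreal (norm (?f k \<omega>))) \<partial>P)"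
    using fg by (intro nn_integral_cong_AE) (elim eventually_mono, simp)
  also have "\<dots> < \<infinity>"
    using summable_rewards unfolding norm_f reward_sum_integrable_def .
  finally have fin: "(\<integral>\<^sup>+\<omega>. (\<Sum>k. ennreal (norm (?g k \<omega>))) \<partial>P) < \<infinity>" .
  then have fin': "(\<Sum>k. \<integral>\<^sup>+\<omega>. ennreal (norm (?g k \<omega>)) \<partial>P) < \<infinity>"
    by (subst nn_integral_suminf[symmetric]) auto
  have int_g: "integrable P (?g k)" for k
    using ennreal_suminf_lessD[OF fin', of k] by (intro integrableI_bounded) auto
  have "AE \<omega> in P. (\<Sum>k. ennreal (norm (?g k \<omega>))) \<noteq> \<infinity>"
    using fin by (intro nn_integral_PInf_AE) auto
  then have sum_g: "AE \<omega> in P. summable (\<lambda>k. norm (?g k \<omega>))"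
    by eventually_elim (auto intro!: summable_suminf_not_top)
  have sum_int: "summable (\<lambda>k. \<integral>\<omega>. norm (?g k \<omega>) \<partial>P)"
  proof (rule summable_suminf_not_top)
    have "ennreal (\<integral>\<omega>. norm (?g k \<omega>) \<partial>P) = (\<integral>\<^sup>+\<omega>. ennreal (norm (?g k \<omega>)) \<partial>P)" for k
      using int_g by (intro nn_integral_eq_integral[symmetric] integrable_norm) auto
    then show "(\<Sum>k. ennreal (\<integral>\<omega>. norm (?g k \<omega>) \<partial>P)) \<noteq> top"
      using fin' by simp
  qed auto
  have "(\<integral>\<omega>. ?g k \<omega> \<partial>P) = \<gamma> ^ k * stage \<pi> k I" for k
  \<comment> \<open>For \<open>\<gamma> = 0\<close> a later reward need not be integrable, but then it does not count.\<close>
  proof (cases "\<gamma> ^ k = 0")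
    case False
    then have "integrable P (\<lambda>\<omega>. indicator (survive k) \<omega> * r k \<omega>)"
      using int_g[of k] integrable_mult_left_iff by metis
    from expected_reward[OF this] show ?thesis by simp
  qed simp
  moreover have "(\<integral>\<omega>. (\<Sum>k. ?f k \<omega>) \<partial>P) = (\<integral>\<omega>. (\<Sum>k. ?g k \<omega>) \<partial>P)"
  proof (rule integral_cong_AE)
    show "AE \<omega> in P. (\<Sum>k. ?f k \<omega>) = (\<Sum>k. ?g k \<omega>)"
      using fg by eventually_elim simp
  qed measurable
  ultimately show ?thesis
    using sums_integral[OF int_g sum_g sum_int] by (simp only:)
qed

end

section \<open>Values and optimality\<close>

context info_mdp
begin

definition policy_value :: "((nat \<Rightarrow> real ^ 'n) \<Rightarrow> 'u) \<Rightarrow> (nat \<Rightarrow> real ^ 'n) \<Rightarrow> real" where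
  "policy_value \<pi> I = (\<Sum>k. \<gamma> ^ k * stage \<pi> k I)"

lemma discounted_stage_bounds:
  assumes "\<pi> \<in> policies X L U" "I \<in> states"
  shows "0 \<le> \<gamma> ^ k * stage \<pi> k I" "\<gamma> ^ k * stage \<pi> k I \<le> \<gamma> ^ k * M"
  using stage_bounds[OF assms, of k] discount by (auto intro: mult_left_mono)

lemma tail_bound_sums: "(\<lambda>k. \<gamma> ^ (k + n) * M) sums (\<gamma> ^ n * (M / (1 - \<gamma>)))"
proof -
  have "(\<lambda>k. (\<gamma> ^ n * M) * \<gamma> ^ k) sums (\<gamma> ^ n * M * (1 / (1 - \<gamma>)))"
    using discount by (intro sums_mult geometric_sums) auto
  then show ?thesis
    by (simp add: power_add ac_simps)
qed

lemma discounted_stage_summable: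
  assumes "\<pi> \<in> policies X L U" "I \<in> states"
  shows "summable (\<lambda>k. \<gamma> ^ k * stage \<pi> k I)"
proof (rule summable_comparison_test)
  show "\<exists>N. \<forall>n\<ge>N. norm (\<gamma> ^ n * stage \<pi> n I) \<le> \<gamma> ^ n * M"
    using discounted_stage_bounds[OF assms] by (metis abs_of_nonneg real_norm_def)
  show "summable (\<lambda>n. \<gamma> ^ n * M)"
    using tail_bound_sums[of 0] by (auto simp: sums_iff)
qed

lemma policy_value_tail:
  assumes "\<pi> \<in> policies X L U" "I \<in> states"
  shows "policy_value \<pi> I - (\<Sum>k<n. \<gamma> ^ k * stage \<pi> k I) \<in> {0..\<gamma> ^ n * (M / (1 - \<gamma>))}"
proof -
  let ?a = "\<lambda>k. \<gamma> ^ k * stage \<pi> k I"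
  have sum: "summable (\<lambda>k. ?a (k + n))"
    using discounted_stage_summable[OF assms] by (subst summable_iff_shift)
  have "policy_value \<pi> I - (\<Sum>k<n. ?a k) = (\<Sum>k. ?a (k + n))"
    using suminf_split_initial_segment[OF discounted_stage_summable[OF assms], of n]
    by (simp add: policy_value_def)
  moreover have "0 \<le> (\<Sum>k. ?a (k + n))"
    by (intro suminf_nonneg sum discounted_stage_bounds assms)
  moreover have "(\<Sum>k. ?a (k + n)) \<le> \<gamma> ^ n * (M / (1 - \<gamma>))"
    unfolding sums_unique[OF tail_bound_sums]
    by (intro suminf_le sum discounted_stage_bounds assms sums_summable[OF tail_bound_sums])
  ultimately show ?thesis by simp
qed

lemma policy_value_bounds:
  assumes "\<pi> \<in> policies X L U" "I \<in> states"
  shows "policy_value \<pi> I \<in> {0..M / (1 - \<gamma>)}"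
  using policy_value_tail[OF assms, of 0] by simp

lemma policy_value_measurable [measurable]:
  assumes "\<pi> \<in> policies X L U"
  shows "policy_value \<pi> \<in> borel_measurable (info_space X L)"
proof -
  note [measurable] = stage_measurable[OF assms]
  show ?thesis
    unfolding policy_value_def[abs_def] by measurable
qed

text \<open>
  The partial sums of the value converge uniformly, by the geometric bound on the tail, and the one-step
  operator is continuous for uniform convergence.
\<close>

lemma nexp_policy_value:
  assumes \<pi>: "\<pi> \<in> policies X L U" and I: "I \<in> states" and u: "u \<in> space U"
  shows "(\<lambda>k. \<gamma> ^ k * nexp (stage \<pi> k) I u) sums nexp (policy_value \<pi>) I u"
proof -
  let ?C = "M / (1 - \<gamma>)"
  let ?V = "\<lambda>n H. \<Sum>k<n. \<gamma> ^ k * stage \<pi> k H"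
  note [measurable] = stage_measurable[OF \<pi>] policy_value_measurable[OF \<pi>]
  have partial: "nexp (?V n) I u = (\<Sum>k<n. \<gamma> ^ k * nexp (stage \<pi> k) I u)" for n
  proof -
    let ?f = "\<lambda>k y. \<gamma> ^ k * (indicator X y * stage \<pi> k (retract (next_info L I y)) * p I u y)"
    have "nexp (?V n) I u = (LINT y|lborel. (\<Sum>k<n. ?f k y))"
      unfolding nexp_retract[OF I]
      by (intro Bochner_Integration.integral_cong) (simp_all add: sum_distrib_left sum_distrib_right ac_simps)
    also have "\<dots> = (\<Sum>k<n. LINT y|lborel. ?f k y)"
      using stage_bounds[OF \<pi>]
      by (intro Bochner_Integration.integral_sum integrable_mult_right nexp_integrable[where C = M] I u) auto
    also have "\<dots> = (\<Sum>k<n. \<gamma> ^ k * nexp (stage \<pi> k) I u)"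
      by (simp add: nexp_retract[OF I])
    finally show ?thesis .
  qed
  have close: "\<bar>nexp (?V n) I u - nexp (policy_value \<pi>) I u\<bar> \<le> \<gamma> ^ n * ?C" for n
  proof (rule nexp_diff_le[OF _ _ _ _ _ I u])
    fix H assume H: "H \<in> states"
    have "0 \<le> ?V n H"
      by (intro sum_nonneg discounted_stage_bounds \<pi> H)
    then show "\<bar>?V n H\<bar> \<le> ?C" "\<bar>policy_value \<pi> H\<bar> \<le> ?C" "\<bar>?V n H - policy_value \<pi> H\<bar> \<le> \<gamma> ^ n * ?C"
      using policy_value_tail[OF \<pi> H, of n] policy_value_bounds[OF \<pi> H] by auto
  qed measurable
  have "(\<lambda>n. \<gamma> ^ n * ?C) \<longlonglongrightarrow> 0"
    using discount by (intro tendsto_mult_left_zero LIMSEQ_power_zero) auto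
  then have "(\<lambda>n. nexp (?V n) I u - nexp (policy_value \<pi>) I u) \<longlonglongrightarrow> 0"
    by (rule Lim_null_comparison[rotated]) (use close in auto)
  then show ?thesis
    unfolding sums_def partial[symmetric] by (rule LIM_zero_cancel)
qed

text \<open>
  The next information state equals \<open>H\<close> only if the next observation equals \<open>H 0\<close>, which has probability
  zero because observations have Lebesgue densities. A change at one point is therefore invisible one step
  ahead.
\<close>

lemma nexp_cong_off_point:
  assumes I: "I \<in> states" and eq: "\<And>I. I \<in> states \<Longrightarrow> I \<noteq> H \<Longrightarrow> J I = J' I"
    and [measurable]: "J \<in> borel_measurable (info_space X L)" "J' \<in> borel_measurable (info_space X L)"
    and u: "u \<in> space U"
  shows "nexp J I u = nexp J' I u"
  unfolding nexp_retract[OF I]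
proof (rule integral_cong_AE)
  note [measurable] = next_info_measurable2[OF I] density_measurable[OF I u]
  show "(\<lambda>y. indicator X y * J (retract (next_info L I y)) * p I u y) \<in> borel_measurable lborel"
    "(\<lambda>y. indicator X y * J' (retract (next_info L I y)) * p I u y) \<in> borel_measurable lborel"
    by measurable
  show "AE y in lborel. indicator X y * J (retract (next_info L I y)) * p I u y
      = indicator X y * J' (retract (next_info L I y)) * p I u y"
    using AE_lborel_singleton[of "H 0"]
  proof eventually_elim
    case (elim y)
    then have "next_info L I y \<noteq> H"
      by (auto simp: next_info_def)
    then show ?case
      using eq next_info_in_states[OF I] by (auto simp: indicator_def retract_id)
  qed
qed

lemma policy_update:
  assumes \<pi>: "\<pi> \<in> policies X L U" and H: "H \<in> states" and u: "u \<in> space U"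
  shows "\<pi>(H := u) \<in> policies X L U"
proof -
  have [measurable]: "\<pi> \<in> info_space X L \<rightarrow>\<^sub>M U"
    using \<pi> by (simp add: policies_def)
  have "{H} = (\<Pi>\<^sub>E j\<in>{..L}. {H j})"
    using H by (intro PiE_singleton[symmetric]) (auto simp: info_states_def PiE_def)
  also have "\<dots> \<in> sets (info_space X L)"
    unfolding info_space_def using H
    by (intro sets_PiM_I_finite) (auto simp: info_states_def sets_restrict_space_iff PiE_iff)
  finally have [measurable]: "{H} \<in> sets (info_space X L)" .
  have "(\<lambda>I. if I \<in> {H} then u else \<pi> I) \<in> info_space X L \<rightarrow>\<^sub>M U"
    using u by (intro measurable_If_set) auto
  then show ?thesis
    by (simp add: policies_def fun_upd_def)
qed

text \<open>
  By induction on \<open>k\<close>: away from \<open>H\<close> the two policies choose the same action now, and the continuations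
  differ at most at \<open>H\<close>.
\<close>

lemma stage_update:
  assumes \<pi>: "\<pi> \<in> policies X L U" and H: "H \<in> states" and u: "u \<in> space U"
    and "I \<in> states" "I \<noteq> H"
  shows "stage (\<pi>(H := u)) k I = stage \<pi> k I"
proof -
  define \<pi>' where "\<pi>' = \<pi>(H := u)"
  have \<pi>': "\<pi>' \<in> policies X L U"
    unfolding \<pi>'_def by (rule policy_update[OF \<pi> H u])
  have "stage \<pi>' k I = stage \<pi> k I"
    using assms(4,5)
  proof (induction k arbitrary: I)
    case 0
    then show ?case by (simp add: \<pi>'_def)
  next
    case (Suc k)
    have "\<pi>' I = \<pi> I"
      using Suc.prems by (simp add: \<pi>'_def)
    moreover have "nexp (stage \<pi>' k) I (\<pi> I) = nexp (stage \<pi> k) I (\<pi> I)"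
      by (rule nexp_cong_off_point[where H = H])
         (use Suc stage_measurable \<pi> \<pi>' policy_action in auto)
    ultimately show ?case by simp
  qed
  then show ?thesis by (simp only: \<pi>'_def)
qed

text \<open>
  Deviating at \<open>H\<close> is a one-shot deviation, since \<open>H\<close> is almost surely never visited again. With
  \<open>u = \<pi> H\<close> this is the evaluation equation of \<open>\<pi>\<close>.
\<close>

lemma policy_value_update:
  assumes \<pi>: "\<pi> \<in> policies X L U" and H: "H \<in> states" and u: "u \<in> space U"
  shows "policy_value (\<pi>(H := u)) H = R (H 0) u + \<gamma> * nexp (policy_value \<pi>) H u"
proof -
  define \<pi>' where "\<pi>' = \<pi>(H := u)"
  have \<pi>': "\<pi>' \<in> policies X L U" "\<pi>' H = u"
    using policy_update[OF \<pi> H u] by (simp_all add: \<pi>'_def)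
  have stage: "stage \<pi>' (Suc k) H = nexp (stage \<pi> k) H u" for k
  proof -
    have "nexp (stage \<pi>' k) H u = nexp (stage \<pi> k) H u"
      by (rule nexp_cong_off_point[where H = H])
         (use stage_update[OF \<pi> H u] stage_measurable \<pi> \<pi>' H u in \<open>auto simp only: \<pi>'_def\<close>)
    then show ?thesis by (simp add: \<pi>'(2))
  qed
  have "(\<lambda>k. \<gamma> * (\<gamma> ^ k * nexp (stage \<pi> k) H u)) sums (\<gamma> * nexp (policy_value \<pi>) H u)"
    by (intro sums_mult nexp_policy_value[OF \<pi> H u])
  then have "(\<lambda>k. \<gamma> ^ Suc k * stage \<pi>' (Suc k) H) sums (\<gamma> * nexp (policy_value \<pi>) H u)"
    unfolding stage by (simp add: ac_simps)
  then have "(\<lambda>k. \<gamma> ^ k * stage \<pi>' k H) sums (\<gamma> * nexp (policy_value \<pi>) H u + R (H 0) u)"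
    using sums_Suc[of "\<lambda>k. \<gamma> ^ k * stage \<pi>' k H"] \<pi>'(2) by simp
  then have "policy_value \<pi>' H = R (H 0) u + \<gamma> * nexp (policy_value \<pi>) H u"
    using sums_unique by (fastforce simp: policy_value_def)
  then show ?thesis
    by (simp only: \<pi>'_def)
qed

text \<open>
  No one-shot deviation improves on \<open>\<pi>\<close> at \<open>I\<close>, and the action \<open>\<pi> I\<close> attains the value, so
  the infimum in the Bellman operator is a minimum equal to the value.
\<close>

lemma optimal_value_fixed_point:
  assumes \<pi>: "\<pi> \<in> policies X L U" and I: "I \<in> states"
    and opt: "\<And>\<pi>'. \<pi>' \<in> policies X L U \<Longrightarrow> policy_value \<pi> I \<le> policy_value \<pi>' I"
  shows "bellman X L U \<gamma> R p (policy_value \<pi>) I = policy_value \<pi> I"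
proof -
  have lower: "policy_value \<pi> I \<le> R (I 0) u + \<gamma> * nexp (policy_value \<pi>) I u" if "u \<in> space U" for u
    using opt[OF policy_update[OF \<pi> I that]] by (simp add: policy_value_update \<pi> I that)
  have attained: "R (I 0) (\<pi> I) + \<gamma> * nexp (policy_value \<pi>) I (\<pi> I) = policy_value \<pi> I"
    using policy_value_update[OF \<pi> I policy_action[OF \<pi> I]] by simp
  have "(INF u\<in>space U. R (I 0) u + \<gamma> * nexp (policy_value \<pi>) I u) = policy_value \<pi> I"
    using lower attained policy_action[OF \<pi> I]
    by (intro cInf_eq_minimum) (auto intro!: image_eqI[of _ _ "\<pi> I"])
  then show ?thesis
    by (simp add: bellman_def next_expectation_def)
qed

text \<open>
  The expressions under the two infima differ by at most \<open>\<gamma> c\<close> for each action. The bound \<open>C\<close> serves to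
  make the infima proper: they range over sets that are bounded below.
\<close>

lemma bellman_contraction:
  assumes J: "J \<in> borel_measurable (info_space X L)" "\<And>I. I \<in> states \<Longrightarrow> \<bar>J I\<bar> \<le> C"
    and J': "J' \<in> borel_measurable (info_space X L)" "\<And>I. I \<in> states \<Longrightarrow> \<bar>J' I\<bar> \<le> C"
    and c: "\<And>I. I \<in> states \<Longrightarrow> \<bar>J I - J' I\<bar> \<le> c" and I: "I \<in> states" and U: "space U \<noteq> {}"
  shows "\<bar>bellman X L U \<gamma> R p J I - bellman X L U \<gamma> R p J' I\<bar> \<le> \<gamma> * c"
proof -
  let ?q = "\<lambda>J u. R (I 0) u + \<gamma> * nexp J I u"
  have one_sided: "(INF u\<in>space U. ?q J u) \<le> (INF u\<in>space U. ?q J' u) + \<gamma> * c"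
    if J: "J \<in> borel_measurable (info_space X L)" "\<And>I. I \<in> states \<Longrightarrow> \<bar>J I\<bar> \<le> C"
    and J': "J' \<in> borel_measurable (info_space X L)" "\<And>I. I \<in> states \<Longrightarrow> \<bar>J' I\<bar> \<le> C"
    and c: "\<And>I. I \<in> states \<Longrightarrow> \<bar>J I - J' I\<bar> \<le> c" for J J'
  proof -
    have "I 0 \<in> X"
      using I by (auto simp: info_states_def)
    have "\<gamma> * (- C) \<le> ?q J u" if u: "u \<in> space U" for u
    proof -
      have "\<bar>nexp J I u - nexp (\<lambda>_. 0) I u\<bar> \<le> C"
        by (rule nexp_diff_le[where C' = 0, OF J _ _ _ I u]) (use J in auto)
      then have "- C \<le> nexp J I u"
        by (simp add: next_expectation_def set_lebesgue_integral_def)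
      then have "\<gamma> * (- C) \<le> \<gamma> * nexp J I u"
        using discount by (intro mult_left_mono) auto
      then show ?thesis
        using R_bounds[OF \<open>I 0 \<in> X\<close> u] by simp
    qed
    then have bdd: "bdd_below (?q J ` space U)"
      by (intro bdd_belowI2)
    have "(INF u\<in>space U. ?q J u) - \<gamma> * c \<le> ?q J' u" if u: "u \<in> space U" for u
    proof -
      have "nexp J I u \<le> nexp J' I u + c"
        using nexp_diff_le[OF J J' c I u] by simp
      then have "\<gamma> * nexp J I u \<le> \<gamma> * (nexp J' I u + c)"
        using discount by (intro mult_left_mono) auto
      then show ?thesis
        using cINF_lower[OF bdd u] by (simp add: algebra_simps)
    qed
    then have "(INF u\<in>space U. ?q J u) - \<gamma> * c \<le> (INF u\<in>space U. ?q J' u)"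
      using U by (intro cINF_greatest)
    then show ?thesis by simp
  qed
  have "\<bar>J' H - J H\<bar> \<le> c" if "H \<in> states" for H
    using c[OF that] by (simp add: abs_minus_commute)
  from one_sided[OF J J' c] one_sided[OF J' J this] show ?thesis
    by (simp add: bellman_def next_expectation_def abs_le_iff)
qed

lemma value_iteration_error:
  assumes \<pi>: "\<pi> \<in> policies X L U"
    and opt: "\<And>\<pi>' I. \<pi>' \<in> policies X L U \<Longrightarrow> I \<in> states \<Longrightarrow> policy_value \<pi> I \<le> policy_value \<pi>' I"
    and J0: "\<And>I. I \<in> states \<Longrightarrow> J 0 I = 0"
    and JSuc: "\<And>k I. I \<in> states \<Longrightarrow> J (Suc k) I = bellman X L U \<gamma> R p (J k) I"
    and meas: "\<And>k. J k \<in> borel_measurable (info_space X L)"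
    and "I \<in> states"
  shows "\<bar>J k I - policy_value \<pi> I\<bar> \<le> \<gamma> ^ k * (M / (1 - \<gamma>))"
  using \<open>I \<in> states\<close>
proof (induction k arbitrary: I)
  case 0
  then show ?case
    using policy_value_bounds[OF \<pi>, of I] by (simp add: J0)
next
  case (Suc k)
  let ?C = "M / (1 - \<gamma>)" and ?V = "policy_value \<pi>"
  have "0 \<le> ?C"
    using policy_value_bounds[OF \<pi> Suc.prems] by auto
  then have small: "\<gamma> ^ k * ?C \<le> ?C"
    using discount by (intro mult_left_le_one_le) (auto intro: power_le_one)
  have "\<bar>bellman X L U \<gamma> R p (J k) I - bellman X L U \<gamma> R p ?V I\<bar> \<le> \<gamma> * (\<gamma> ^ k * ?C)"
  \<comment> \<open>The iterate is within \<open>?C\<close> of the value, which is itself at most \<open>?C\<close>; hence \<open>2 * ?C\<close>.\<close>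
  proof (rule bellman_contraction[OF meas _ policy_value_measurable[OF \<pi>] _ Suc.IH Suc.prems, where C = "2 * ?C"])
    fix H assume H: "H \<in> states"
    show "\<bar>J k H\<bar> \<le> 2 * ?C" "\<bar>?V H\<bar> \<le> 2 * ?C"
      using Suc.IH[OF H] policy_value_bounds[OF \<pi> H] small by (auto simp del: times_divide_eq_right)
  qed (use policy_action[OF \<pi> Suc.prems] in auto)
  then show ?case
    using optimal_value_fixed_point[OF \<pi> Suc.prems opt] Suc.prems by (simp add: JSuc ac_simps)
qed

end

theorem theorem2:
  fixes X :: "(real ^ 'n) set" and S :: "'s set" and U :: "'u measure"
    and L :: nat and \<gamma> M :: real
    and px :: "real ^ 'n \<Rightarrow> 's \<Rightarrow> 'u \<Rightarrow> real ^ 'n \<Rightarrow> real"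
    and ps :: "'s \<Rightarrow> real ^ 'n \<Rightarrow> 's pmf"
    and \<rho> :: "real ^ 'n \<Rightarrow> 'u \<Rightarrow> real measure"
    and p :: "(nat \<Rightarrow> real ^ 'n) \<Rightarrow> 'u \<Rightarrow> real ^ 'n \<Rightarrow> real"
    and x :: "int \<Rightarrow> 'w \<Rightarrow> real ^ 'n" and s :: "nat \<Rightarrow> 'w \<Rightarrow> 's" and r :: "nat \<Rightarrow> 'w \<Rightarrow> real"
    and P :: "((nat \<Rightarrow> real ^ 'n) \<Rightarrow> 'u) \<Rightarrow> (nat \<Rightarrow> real ^ 'n) \<Rightarrow> 'w measure"
    and J :: "nat \<Rightarrow> (nat \<Rightarrow> real ^ 'n) \<Rightarrow> real"
    and \<pi>star :: "(nat \<Rightarrow> real ^ 'n) \<Rightarrow> 'u"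
  assumes "compact X" and "X \<noteq> {}" and "finite S"
    and "0 \<le> \<gamma>" and "\<gamma> < 1" and "0 < M"
    and "state_density X S U px" and "discrete_kernel X S ps" and "reward_kernel X U \<rho>"
    and "\<And>a u. a \<in> X \<Longrightarrow> u \<in> space U \<Longrightarrow> mean_reward \<rho> a u \<in> {0..M}"
    and "info_density X L U p"
    and "\<And>\<pi> I. \<pi> \<in> policies X L U \<Longrightarrow> I \<in> info_states X L \<Longrightarrow>
           controlled_process X S L px ps \<rho> x s r \<pi> I (P \<pi> I)"
    and "\<And>\<pi> I. \<pi> \<in> policies X L U \<Longrightarrow> I \<in> info_states X L \<Longrightarrow>
           markov_info X L p x \<pi> (P \<pi> I)"
    and "\<And>\<pi> I. \<pi> \<in> policies X L U \<Longrightarrow> I \<in> info_states X L \<Longrightarrow>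
           reward_sum_integrable X \<gamma> x r (P \<pi> I)"
    and "optimal_policy X L U (value_fun X \<gamma> x r P) \<pi>star"
    and "\<And>I. I \<in> info_states X L \<Longrightarrow> J 0 I = 0"
    and "\<And>k I. I \<in> info_states X L \<Longrightarrow>
           J (Suc k) I = bellman X L U \<gamma> (mean_reward \<rho>) p (J k) I"
    and "\<And>k. J k \<in> borel_measurable (info_space X L)"
  shows "uniform_limit (info_states X L) J (value_fun X \<gamma> x r P \<pi>star) sequentially \<and>
         (\<lambda>k. sup_dist X L (J k) (value_fun X \<gamma> x r P \<pi>star)) \<longlonglongrightarrow> 0"
proof -
  let ?R = "mean_reward \<rho>" and ?V = "value_fun X \<gamma> x r P" and ?C = "M / (1 - \<gamma>)"
  interpret info_mdp X L U p ?R M \<gamma>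
  proof
    show "X \<in> sets borel"
      using assms(1) by (intro borel_closed compact_imp_closed)
    have "(\<lambda>z. case z of (a, u) \<Rightarrow> \<rho> a u) \<in> restrict_space borel X \<Otimes>\<^sub>M U \<rightarrow>\<^sub>M subprob_algebra borel"
      using assms(9) by (auto simp: reward_kernel_def intro: measurable_prob_algebraD)
    then have "(\<lambda>z. \<integral>v. v \<partial>(case z of (a, u) \<Rightarrow> \<rho> a u)) \<in> borel_measurable (restrict_space borel X \<Otimes>\<^sub>M U)"
      by (rule measurable_compose[OF _ integral_measurable_subprob_algebra]) simp
    then show "(\<lambda>(a, u). ?R a u) \<in> borel_measurable (restrict_space borel X \<Otimes>\<^sub>M U)"
      by (simp add: mean_reward_def split_beta)
  qed (use assms in auto)
  have V: "?V \<pi> I = policy_value \<pi> I" if "\<pi> \<in> policies X L U" "I \<in> info_states X L" for \<pi> I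
  proof -
    interpret info_trajectory X L U p \<rho> M \<gamma> S px ps x s r \<pi> I "P \<pi> I"
      by unfold_locales (use assms that in auto)
    show ?thesis
      using expected_discounted_reward by (simp add: value_fun_def policy_value_def sums_iff)
  qed
  have \<pi>: "\<pi>star \<in> policies X L U"
    using assms(15) by (simp add: optimal_policy_def)
  have opt: "policy_value \<pi>star I \<le> policy_value \<pi>' I"
    if \<pi>': "\<pi>' \<in> policies X L U" and I: "I \<in> info_states X L" for \<pi>' I
  proof -
    have "bdd_below ((\<lambda>\<pi>. ?V \<pi> I) ` policies X L U)"
      using policy_value_bounds I by (intro bdd_belowI2[of _ 0]) (auto simp: V)
    then have "?V \<pi>star I \<le> ?V \<pi>' I"
      using assms(15) \<pi>' I by (auto simp: optimal_policy_def intro: cINF_lower)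
    then show ?thesis
      by (simp add: V \<pi> \<pi>' I)
  qed
  have error: "\<bar>J k I - ?V \<pi>star I\<bar> \<le> \<gamma> ^ k * ?C" if "I \<in> info_states X L" for k I
    using value_iteration_error[OF \<pi> opt assms(16-18) that] by (simp add: V \<pi> that)
  have lim: "(\<lambda>k. \<gamma> ^ k * ?C) \<longlonglongrightarrow> 0"
    using assms(4,5) by (intro tendsto_mult_left_zero LIMSEQ_power_zero) auto
  show ?thesis
  proof
    show "uniform_limit (info_states X L) J (?V \<pi>star) sequentially"
    proof (rule uniform_limitI)
      fix e :: real assume "0 < e"
      from order_tendstoD(2)[OF lim this]
      show "\<forall>\<^sub>F k in sequentially. \<forall>I\<in>info_states X L. dist (J k I) (?V \<pi>star I) < e"
        by eventually_elim (use error in \<open>auto simp: dist_real_def intro: le_less_trans\<close>)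
    qed
    have sup: "0 \<le> sup_dist X L (J k) (?V \<pi>star)" "sup_dist X L (J k) (?V \<pi>star) \<le> \<gamma> ^ k * ?C" for k
    proof -
      obtain I where I: "I \<in> info_states X L"
        using states_nonempty by auto
      have "bdd_above ((\<lambda>I. \<bar>J k I - ?V \<pi>star I\<bar>) ` info_states X L)"
        using error by (intro bdd_aboveI2)
      from cSUP_upper[OF I this] show "0 \<le> sup_dist X L (J k) (?V \<pi>star)"
        unfolding sup_dist_def by (rule order_trans[OF abs_ge_zero])
      show "sup_dist X L (J k) (?V \<pi>star) \<le> \<gamma> ^ k * ?C"
        unfolding sup_dist_def using states_nonempty error by (intro cSUP_least)
    qed
    show "(\<lambda>k. sup_dist X L (J k) (?V \<pi>star)) \<longlonglongrightarrow> 0"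
      using sup by (intro tendsto_sandwich[OF _ _ tendsto_const lim]) auto
  qed
qed

end
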